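(* Let $\kappa$ be a regular cardinal such that there is an infinite regular cardinal $\lambda<\kappa$. Let $\{p_j:\mathcal{E}_j\to\mathcal{B}\}_{j\in J}$ be a $\kappa$-small family of functors over the same base category $\mathcal{B}$, let $\mathcal{E}=\times_{\mathcal{B}}\mathcal{E}_j$ be a $2$-pullback (pseudopullback) of this family, and let $p:\mathcal{E}\to\mathcal{B}$ be the canonical projection. Assume that: (1) for every $j\in J$ and every $e_j\in\mathcal{E}_j$, all displacements of $e_j$ (with respect to $p_j$, along every morphism $p_j(e_j)\to b$ of $\mathcal{B}$) exist; (2) every $p_j$ creates (and hence preserves) filtered colimits in $\mathcal{E}_j$; (3) $\mathcal{B}$ is closed under $\kappa$-small filtered colimits; (4) $\mathcal{B}$ is closed under $\kappa$-small wide pushouts. Then for every $e\in\mathcal{E}$, all displacements of $e$ (with respect to $p$, along every morphism $p(e)\to b$ of $\mathcal{B}$) exist. Furthermore, if $\mathcal{B}$ is equipped with two classes of maps called cofibrations and trivial cofibrations, each of them closed under transfinite composition and cobase change, and if each $p_j:\mathcal{E}_j\to\mathcal{B}$ is left perfect, then $p:\mathcal{E}\to\mathcal{B}$ is left perfect.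
   Context: Displacement: let $p:\mathcal{E}\to\mathcal{B}$ be a functor, $e$ an object of $\mathcal{E}$ and $\varepsilon:p(e)\to b$ a morphism of $\mathcal{B}$. A displacement of $e$ along $\varepsilon$ is an object $\eta:e\to\nabla_\varepsilon(e)$ of the under-category $(e\downarrow\mathcal{E})$ that corepresents the functor $(e\downarrow\mathcal{E})\to\mathbf{Set}$, $(h:e\to e')\mapsto\mathrm{Hom}_{(p(e)\downarrow\mathcal{B})}(\varepsilon,p(h))$. Explicitly, there is a universal map $u:b\to p(\nabla_\varepsilon(e))$ with $p(\eta)=u\varepsilon$, such that for every $h:e\to e'$ in $\mathcal{E}$ and every $q:b\to p(e')$ with $p(h)=q\varepsilon$ there is a unique $\xi:\nabla_\varepsilon(e)\to e'$ with $h=\xi\eta$ and $q=p(\xi)u$. Left perfectness: suppose $\mathcal{B}$ has two classes of morphisms called cofibrations and trivial cofibrations, each closed under transfinite composition and cobase change. A functor $p:\mathcal{E}\to\mathcal{B}$ is left perfect at $e\in\mathcal{E}$ if for every cofibration (resp. trivial cofibration) $\varepsilon:p(e)\to b$ in $\mathcal{B}$, the universal map $u:b\to p(\nabla_\varepsilon(e))$ is also a cofibration (resp. trivial cofibration), for a displacement $e\to\nabla_\varepsilon(e)$ of $e$ along $\varepsilon$. It is left perfect if it is left perfect at every object of $\mathcal{E}$. Pseudopullback: as a model for $\mathcal{E}=\times_{\mathcal{B}}\mathcal{E}_j$ one takes the category whose objects are families of isomorphisms $\{b\xrightarrow{\cong}p_j(e_j);\ e_j\in\mathcal{E}_j\}_{j\in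 J}$ with common source $b\in\mathcal{B}$, and whose morphisms from $\{b\cong p_j(e_j)\}_j$ to $\{c\cong p_j(f_j)\}_j$ consist of a morphism $\sigma:b\to c$ in $\mathcal{B}$ and morphisms $\sigma_j:e_j\to f_j$ in $\mathcal{E}_j$ such that for each $j$ the composite $b\xrightarrow{\cong}p_j(e_j)\xrightarrow{p_j(\sigma_j)}p_j(f_j)$ equals $b\xrightarrow{\sigma}c\xrightarrow{\cong}p_j(f_j)$. The canonical projection $p:\mathcal{E}\to\mathcal{B}$ sends $\{b\cong p_j(e_j)\}_j$ to $b$; the projection $\tau_j:\mathcal{E}\to\mathcal{E}_j$ sends it to $e_j$, and $p\cong p_j\tau_j$ for each $j$. *)

theory Defs
  imports Main "HOL-Library.FuncSet"
begin

unbundle cardinal_syntax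

section \<open>Categories and functors\<close>

text \<open>Arrows know their domain and codomain; composition is written in the usual order,
  i.e. \<open>g \<cdot>\<^bsub>C\<^esub> f\<close> is "g after f".\<close>

record ('o, 'm) cat =
  Ob :: "'o set"
  Ar :: "'m set"
  Dom :: "'m \<Rightarrow> 'o"
  Cod :: "'m \<Rightarrow> 'o"
  Idn :: "'o \<Rightarrow> 'm"
  Cmp :: "'m \<Rightarrow> 'm \<Rightarrow> 'm" (infixl "\<cdot>\<index>" 70)

definition hom :: "('o, 'm) cat \<Rightarrow> 'o \<Rightarrow> 'o \<Rightarrow> 'm set" where
  "hom C a b = {f \<in> Ar C. Dom C f = a \<and> Cod C f = b}"

definition category :: "('o, 'm) cat \<Rightarrow> bool" where
  "category C \<longleftrightarrow>
     (\<forall>f\<in>Ar C. Dom C f \<in> Ob C \<and> Cod C f \<in> Ob C) \<and>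
     (\<forall>a\<in>Ob C. Idn C a \<in> hom C a a) \<and>
     (\<forall>f\<in>Ar C. \<forall>g\<in>Ar C. Cod C f = Dom C g \<longrightarrow> g \<cdot>\<^bsub>C\<^esub> f \<in> hom C (Dom C f) (Cod C g)) \<and>
     (\<forall>f\<in>Ar C. f \<cdot>\<^bsub>C\<^esub> Idn C (Dom C f) = f \<and> Idn C (Cod C f) \<cdot>\<^bsub>C\<^esub> f = f) \<and>
     (\<forall>f\<in>Ar C. \<forall>g\<in>Ar C. \<forall>h\<in>Ar C. Cod C f = Dom C g \<and> Cod C g = Dom C h \<longrightarrow>
        h \<cdot>\<^bsub>C\<^esub> (g \<cdot>\<^bsub>C\<^esub> f) = (h \<cdot>\<^bsub>C\<^esub> g) \<cdot>\<^bsub>C\<^esub> f)"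

definition iso_in :: "('o, 'm) cat \<Rightarrow> 'm \<Rightarrow> bool" where
  "iso_in C f \<longleftrightarrow> f \<in> Ar C \<and>
     (\<exists>g\<in>hom C (Cod C f) (Dom C f).
        g \<cdot>\<^bsub>C\<^esub> f = Idn C (Dom C f) \<and> f \<cdot>\<^bsub>C\<^esub> g = Idn C (Cod C f))"

record ('o, 'm, 'p, 'n) ftr =
  FOb :: "'o \<Rightarrow> 'p"
  FAr :: "'m \<Rightarrow> 'n"

definition is_functor ::
    "('o, 'm) cat \<Rightarrow> ('p, 'n) cat \<Rightarrow> ('o, 'm, 'p, 'n) ftr \<Rightarrow> bool" where
  "is_functor C D F \<longleftrightarrow>
     (\<forall>a\<in>Ob C. FOb F a \<in> Ob D \<and> FAr F (Idn C a) = Idn D (FOb F a)) \<and>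
     (\<forall>f\<in>Ar C. FAr F f \<in> hom D (FOb F (Dom C f)) (FOb F (Cod C f))) \<and>
     (\<forall>f\<in>Ar C. \<forall>g\<in>Ar C. Cod C f = Dom C g \<longrightarrow>
        FAr F (g \<cdot>\<^bsub>C\<^esub> f) = FAr F g \<cdot>\<^bsub>D\<^esub> FAr F f)"

definition comp_ftr ::
    "('p, 'n, 'q, 'l) ftr \<Rightarrow> ('o, 'm, 'p, 'n) ftr \<Rightarrow> ('o, 'm, 'q, 'l) ftr" where
  "comp_ftr G F = \<lparr> FOb = FOb G \<circ> FOb F, FAr = FAr G \<circ> FAr F \<rparr>"


section \<open>Colimits\<close>

definition is_cocone ::
    "('i, 'k) cat \<Rightarrow> ('o, 'm) cat \<Rightarrow> ('i, 'k, 'o, 'm) ftr \<Rightarrow> 'o \<Rightarrow> ('i \<Rightarrow> 'm) \<Rightarrow> bool" where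
  "is_cocone I C D c \<mu> \<longleftrightarrow> c \<in> Ob C \<and>
     (\<forall>i\<in>Ob I. \<mu> i \<in> hom C (FOb D i) c) \<and>
     (\<forall>f\<in>Ar I. \<mu> (Cod I f) \<cdot>\<^bsub>C\<^esub> FAr D f = \<mu> (Dom I f))"

definition is_colimit ::
    "('i, 'k) cat \<Rightarrow> ('o, 'm) cat \<Rightarrow> ('i, 'k, 'o, 'm) ftr \<Rightarrow> 'o \<Rightarrow> ('i \<Rightarrow> 'm) \<Rightarrow> bool" where
  "is_colimit I C D c \<mu> \<longleftrightarrow> is_cocone I C D c \<mu> \<and>
     (\<forall>c' \<mu>'. is_cocone I C D c' \<mu>' \<longrightarrow>
        (\<exists>!h. h \<in> hom C c c' \<and> (\<forall>i\<in>Ob I. h \<cdot>\<^bsub>C\<^esub> \<mu> i = \<mu>' i)))"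

definition has_colimit ::
    "('i, 'k) cat \<Rightarrow> ('o, 'm) cat \<Rightarrow> ('i, 'k, 'o, 'm) ftr \<Rightarrow> bool" where
  "has_colimit I C D \<longleftrightarrow> (\<exists>c \<mu>. is_colimit I C D c \<mu>)"

definition filtered :: "('o, 'm) cat \<Rightarrow> bool" where
  "filtered I \<longleftrightarrow> category I \<and> Ob I \<noteq> {} \<and>
     (\<forall>a\<in>Ob I. \<forall>b\<in>Ob I. \<exists>c\<in>Ob I. hom I a c \<noteq> {} \<and> hom I b c \<noteq> {}) \<and>
     (\<forall>a\<in>Ob I. \<forall>b\<in>Ob I. \<forall>f\<in>hom I a b. \<forall>g\<in>hom I a b.
        \<exists>c\<in>Ob I. \<exists>h\<in>hom I b c. h \<cdot>\<^bsub>I\<^esub> f = h \<cdot>\<^bsub>I\<^esub> g)"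

text \<open>The type variable \<open>'u\<close> plays the role of the universe of small sets throughout:
  a small diagram is, up to isomorphism of its shape, one whose objects and arrows are of
  type \<open>'u\<close>, a small ordinal is a well-order on a subset of \<open>'u\<close>, and the cardinal \<open>\<kappa>\<close>
  is a cardinal order on a subset of \<open>'u\<close>.  In particular every \<open>\<kappa>\<close>-small category
  is isomorphic to one over \<open>'u\<close>.  For infinite \<open>\<kappa>\<close>, bounding the number of arrows of a
  category bounds the number of its objects as well.\<close>

definition has_small_filtered_colimits :: "'u rel \<Rightarrow> ('o, 'm) cat \<Rightarrow> bool" where
  "has_small_filtered_colimits \<kappa> C \<longleftrightarrow>
     (\<forall>(I :: ('u, 'u) cat) D. filtered I \<and> |Ar I| <o \<kappa> \<and> is_functor I C D \<longrightarrow> has_colimit I C D)"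

text \<open>Creation of filtered colimits, in the form that is invariant under equivalence:
  a colimit of the image of a diagram gives a colimit of the diagram, and the colimit cocones
  on the diagram are then exactly the cocones whose image is a colimit cocone (preservation and
  reflection).  Creation in the strict sense (unique lifts on the nose) implies this.\<close>

definition creates_filtered_colimits ::
    "'u itself \<Rightarrow> ('o, 'm) cat \<Rightarrow> ('p, 'n) cat \<Rightarrow> ('o, 'm, 'p, 'n) ftr \<Rightarrow> bool" where
  "creates_filtered_colimits U E B p \<longleftrightarrow>
     (\<forall>(I :: ('u, 'u) cat) D. filtered I \<and> is_functor I E D \<and> has_colimit I B (comp_ftr p D) \<longrightarrow>
        has_colimit I E D \<and>
        (\<forall>c \<mu>. is_cocone I E D c \<mu> \<longrightarrow>
           (is_colimit I E D c \<mu> \<longleftrightarrow>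
            is_colimit I B (comp_ftr p D) (FOb p c) (\<lambda>i. FAr p (\<mu> i)))))"

text \<open>Wide pushout of a family of arrows \<open>f k\<close> with common domain \<open>a\<close>: the colimiting
  cocone has legs \<open>m\<close> out of \<open>a\<close> and \<open>q k\<close> out of \<open>Cod C (f k)\<close>.  The leg \<open>m\<close> is
  redundant unless the family is empty.\<close>

definition wide_cocone ::
    "('o, 'm) cat \<Rightarrow> 'k set \<Rightarrow> 'o \<Rightarrow> ('k \<Rightarrow> 'm) \<Rightarrow> 'o \<Rightarrow> 'm \<Rightarrow> ('k \<Rightarrow> 'm) \<Rightarrow> bool" where
  "wide_cocone C K a f w m q \<longleftrightarrow> w \<in> Ob C \<and> m \<in> hom C a w \<and>
     (\<forall>k\<in>K. q k \<in> hom C (Cod C (f k)) w \<and> q k \<cdot>\<^bsub>C\<^esub> f k = m)"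

definition is_wide_pushout ::
    "('o, 'm) cat \<Rightarrow> 'k set \<Rightarrow> 'o \<Rightarrow> ('k \<Rightarrow> 'm) \<Rightarrow> 'o \<Rightarrow> 'm \<Rightarrow> ('k \<Rightarrow> 'm) \<Rightarrow> bool" where
  "is_wide_pushout C K a f w m q \<longleftrightarrow> wide_cocone C K a f w m q \<and>
     (\<forall>w' m' q'. wide_cocone C K a f w' m' q' \<longrightarrow>
        (\<exists>!h. h \<in> hom C w w' \<and> h \<cdot>\<^bsub>C\<^esub> m = m' \<and> (\<forall>k\<in>K. h \<cdot>\<^bsub>C\<^esub> q k = q' k)))"

definition has_small_wide_pushouts :: "'u rel \<Rightarrow> ('o, 'm) cat \<Rightarrow> bool" where
  "has_small_wide_pushouts \<kappa> C \<longleftrightarrow>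
     (\<forall>(K :: 'u set) a f. |K| <o \<kappa> \<and> a \<in> Ob C \<and> (\<forall>k\<in>K. f k \<in> Ar C \<and> Dom C (f k) = a) \<longrightarrow>
        (\<exists>w m q. is_wide_pushout C K a f w m q))"


section \<open>Cobase change and transfinite composition\<close>

text \<open>The square \<open>f' \<cdot> g = g' \<cdot> f\<close> is a pushout, so \<open>f'\<close> is the cobase change of
  \<open>f\<close> along \<open>g\<close>.\<close>

definition is_pushout :: "('o, 'm) cat \<Rightarrow> 'm \<Rightarrow> 'm \<Rightarrow> 'm \<Rightarrow> 'm \<Rightarrow> bool" where
  "is_pushout C f g g' f' \<longleftrightarrow>
     f \<in> Ar C \<and> g \<in> Ar C \<and> g' \<in> Ar C \<and> f' \<in> Ar C \<and>
     Dom C f = Dom C g \<and> Dom C g' = Cod C f \<and> Dom C f' = Cod C g \<and> Cod C g' = Cod C f' \<and>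
     g' \<cdot>\<^bsub>C\<^esub> f = f' \<cdot>\<^bsub>C\<^esub> g \<and>
     (\<forall>x\<in>Ob C. \<forall>s\<in>hom C (Cod C f) x. \<forall>t\<in>hom C (Cod C g) x.
        s \<cdot>\<^bsub>C\<^esub> f = t \<cdot>\<^bsub>C\<^esub> g \<longrightarrow>
        (\<exists>!h. h \<in> hom C (Cod C f') x \<and> h \<cdot>\<^bsub>C\<^esub> g' = s \<and> h \<cdot>\<^bsub>C\<^esub> f' = t))"

definition closed_cobase_change :: "('o, 'm) cat \<Rightarrow> 'm set \<Rightarrow> bool" where
  "closed_cobase_change C W \<longleftrightarrow> (\<forall>f g g' f'. f \<in> W \<and> is_pushout C f g g' f' \<longrightarrow> f' \<in> W)"

definition order_cat :: "'a rel \<Rightarrow> ('a, 'a \<times> 'a) cat" where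
  "order_cat r = \<lparr> Ob = Field r, Ar = r, Dom = fst, Cod = snd, Idn = (\<lambda>i. (i, i)),
     Cmp = (\<lambda>g f. (fst f, snd g)) \<rparr>"

definition covers :: "'a rel \<Rightarrow> 'a \<Rightarrow> 'a \<Rightarrow> bool" where
  "covers r i j \<longleftrightarrow> (i, j) \<in> r \<and> i \<noteq> j \<and> (\<forall>k. (i, k) \<in> r \<and> (k, j) \<in> r \<longrightarrow> k = i \<or> k = j)"

definition limit_elem :: "'a rel \<Rightarrow> 'a \<Rightarrow> bool" where
  "limit_elem r j \<longleftrightarrow> j \<in> Field r \<and> underS r j \<noteq> {} \<and> (\<forall>i. \<not> covers r i j)"

text \<open>A transfinite sequence of arrows in \<open>W\<close>, indexed by a nonzero ordinal: a functor on a
  nonempty well-order that is continuous at limit elements.\<close>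

definition transfinite_sequence ::
    "('o, 'm) cat \<Rightarrow> 'm set \<Rightarrow> 'u rel \<Rightarrow> ('u, 'u \<times> 'u, 'o, 'm) ftr \<Rightarrow> bool" where
  "transfinite_sequence C W r X \<longleftrightarrow>
     Well_order r \<and> Field r \<noteq> {} \<and> is_functor (order_cat r) C X \<and>
     (\<forall>i j. covers r i j \<longrightarrow> FAr X (i, j) \<in> W) \<and>
     (\<forall>j. limit_elem r j \<longrightarrow>
        is_colimit (order_cat (Restr r (underS r j))) C X (FOb X j) (\<lambda>i. FAr X (i, j)))"

text \<open>The transfinite composite of \<open>X\<close> is the leg at the bottom element of a colimit cocone.
  The one-element order shows that a class closed under transfinite composition contains
  all isomorphisms.\<close>

definition closed_transfinite_composition ::
    "'u itself \<Rightarrow> ('o, 'm) cat \<Rightarrow> 'm set \<Rightarrow> bool" where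
  "closed_transfinite_composition U C W \<longleftrightarrow>
     (\<forall>(r :: 'u rel) X c \<mu> z. transfinite_sequence C W r X \<and> is_colimit (order_cat r) C X c \<mu> \<and>
        z \<in> Field r \<and> underS r z = {} \<longrightarrow> \<mu> z \<in> W)"

definition cofibration_class :: "'u itself \<Rightarrow> ('o, 'm) cat \<Rightarrow> 'm set \<Rightarrow> bool" where
  "cofibration_class U C W \<longleftrightarrow>
     W \<subseteq> Ar C \<and> closed_transfinite_composition U C W \<and> closed_cobase_change C W"


section \<open>Displacements and left perfectness\<close>

text \<open>\<open>\<eta>\<close> is a displacement of \<open>e\<close> along \<open>\<epsilon>\<close> with universal map \<open>u\<close>; the displaced
  object is \<open>Cod E \<eta>\<close>.\<close>

definition is_displacement ::
    "('eo, 'em) cat \<Rightarrow> ('bo, 'bm) cat \<Rightarrow> ('eo, 'em, 'bo, 'bm) ftr \<Rightarrow>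
     'eo \<Rightarrow> 'bm \<Rightarrow> 'em \<Rightarrow> 'bm \<Rightarrow> bool" where
  "is_displacement E B p e \<epsilon> \<eta> u \<longleftrightarrow>
     \<eta> \<in> Ar E \<and> Dom E \<eta> = e \<and> u \<in> hom B (Cod B \<epsilon>) (FOb p (Cod E \<eta>)) \<and>
     FAr p \<eta> = u \<cdot>\<^bsub>B\<^esub> \<epsilon> \<and>
     (\<forall>e'\<in>Ob E. \<forall>h\<in>hom E e e'. \<forall>q\<in>hom B (Cod B \<epsilon>) (FOb p e').
        FAr p h = q \<cdot>\<^bsub>B\<^esub> \<epsilon> \<longrightarrow>
        (\<exists>!\<xi>. \<xi> \<in> hom E (Cod E \<eta>) e' \<and> h = \<xi> \<cdot>\<^bsub>E\<^esub> \<eta> \<and> q = FAr p \<xi> \<cdot>\<^bsub>B\<^esub> u))"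

definition has_displacements ::
    "('eo, 'em) cat \<Rightarrow> ('bo, 'bm) cat \<Rightarrow> ('eo, 'em, 'bo, 'bm) ftr \<Rightarrow> 'eo \<Rightarrow> bool" where
  "has_displacements E B p e \<longleftrightarrow>
     (\<forall>\<epsilon>\<in>Ar B. Dom B \<epsilon> = FOb p e \<longrightarrow> (\<exists>\<eta> u. is_displacement E B p e \<epsilon> \<eta> u))"

text \<open>Displacements are unique up to isomorphism and the classes considered are closed under
  composition with isomorphisms, so it does not matter which displacement is used.\<close>

definition left_perfect_at ::
    "('eo, 'em) cat \<Rightarrow> ('bo, 'bm) cat \<Rightarrow> ('eo, 'em, 'bo, 'bm) ftr \<Rightarrow>
     'bm set \<Rightarrow> 'bm set \<Rightarrow> 'eo \<Rightarrow> bool" where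
  "left_perfect_at E B p cof tcof e \<longleftrightarrow>
     (\<forall>\<epsilon>\<in>cof. Dom B \<epsilon> = FOb p e \<longrightarrow> (\<exists>\<eta> u. is_displacement E B p e \<epsilon> \<eta> u \<and> u \<in> cof)) \<and>
     (\<forall>\<epsilon>\<in>tcof. Dom B \<epsilon> = FOb p e \<longrightarrow> (\<exists>\<eta> u. is_displacement E B p e \<epsilon> \<eta> u \<and> u \<in> tcof))"

definition left_perfect ::
    "('eo, 'em) cat \<Rightarrow> ('bo, 'bm) cat \<Rightarrow> ('eo, 'em, 'bo, 'bm) ftr \<Rightarrow>
     'bm set \<Rightarrow> 'bm set \<Rightarrow> bool" where
  "left_perfect E B p cof tcof \<longleftrightarrow> (\<forall>e\<in>Ob E. left_perfect_at E B p cof tcof e)"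


section \<open>Pseudopullbacks\<close>

text \<open>An object is a triple \<open>(b, e, i)\<close> of an object \<open>b\<close> of the base, a family of objects
  \<open>e j\<close>, and a family of isomorphisms \<open>i j : b \<rightarrow> P j (e j)\<close>.  Families are extensional
  functions on \<open>J\<close>, so that equality of objects and of arrows is the intended one.  An arrow
  carries its domain and codomain, because the underlying arrows \<open>(\<sigma>, s)\<close> do not determine
  the isomorphisms \<open>i\<close> and \<open>i'\<close>.\<close>

type_synonym ('j, 'eo, 'bo, 'bm) pp_ob = "'bo \<times> ('j \<Rightarrow> 'eo) \<times> ('j \<Rightarrow> 'bm)"

type_synonym ('j, 'eo, 'em, 'bo, 'bm) pp_ar =
  "('j, 'eo, 'bo, 'bm) pp_ob \<times> ('j, 'eo, 'bo, 'bm) pp_ob \<times> 'bm \<times> ('j \<Rightarrow> 'em)"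

definition pp_obs ::
    "'j set \<Rightarrow> ('j \<Rightarrow> ('eo, 'em) cat) \<Rightarrow> ('bo, 'bm) cat \<Rightarrow> ('j \<Rightarrow> ('eo, 'em, 'bo, 'bm) ftr) \<Rightarrow>
     ('j, 'eo, 'bo, 'bm) pp_ob set" where
  "pp_obs J E B P = {(b, e, i). b \<in> Ob B \<and> e \<in> (\<Pi>\<^sub>E j\<in>J. Ob (E j)) \<and>
     i \<in> (\<Pi>\<^sub>E j\<in>J. {f \<in> hom B b (FOb (P j) (e j)). iso_in B f})}"

definition pp_ars ::
    "'j set \<Rightarrow> ('j \<Rightarrow> ('eo, 'em) cat) \<Rightarrow> ('bo, 'bm) cat \<Rightarrow> ('j \<Rightarrow> ('eo, 'em, 'bo, 'bm) ftr) \<Rightarrow>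
     ('j, 'eo, 'em, 'bo, 'bm) pp_ar set" where
  "pp_ars J E B P = {((b, e, i), (b', e', i'), \<sigma>, s).
     (b, e, i) \<in> pp_obs J E B P \<and> (b', e', i') \<in> pp_obs J E B P \<and>
     \<sigma> \<in> hom B b b' \<and> s \<in> (\<Pi>\<^sub>E j\<in>J. hom (E j) (e j) (e' j)) \<and>
     (\<forall>j\<in>J. FAr (P j) (s j) \<cdot>\<^bsub>B\<^esub> i j = i' j \<cdot>\<^bsub>B\<^esub> \<sigma>)}"

definition pseudopullback ::
    "'j set \<Rightarrow> ('j \<Rightarrow> ('eo, 'em) cat) \<Rightarrow> ('bo, 'bm) cat \<Rightarrow> ('j \<Rightarrow> ('eo, 'em, 'bo, 'bm) ftr) \<Rightarrow>
     (('j, 'eo, 'bo, 'bm) pp_ob, ('j, 'eo, 'em, 'bo, 'bm) pp_ar) cat" where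
  "pseudopullback J E B P = \<lparr> Ob = pp_obs J E B P, Ar = pp_ars J E B P,
     Dom = (\<lambda>(x, y, \<sigma>, s). x),
     Cod = (\<lambda>(x, y, \<sigma>, s). y),
     Idn = (\<lambda>(b, e, i). ((b, e, i), (b, e, i), Idn B b, \<lambda>j\<in>J. Idn (E j) (e j))),
     Cmp = (\<lambda>(y', z, \<tau>, t) (x, y, \<sigma>, s). (x, z, \<tau> \<cdot>\<^bsub>B\<^esub> \<sigma>, \<lambda>j\<in>J. t j \<cdot>\<^bsub>E j\<^esub> s j)) \<rparr>"

definition pp_proj ::
    "(('j, 'eo, 'bo, 'bm) pp_ob, ('j, 'eo, 'em, 'bo, 'bm) pp_ar, 'bo, 'bm) ftr" where
  "pp_proj = \<lparr> FOb = (\<lambda>(b, e, i). b), FAr = (\<lambda>(x, y, \<sigma>, s). \<sigma>) \<rparr>"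

lemma category_order_cat:
  assumes "Well_order r"
  shows "category (order_cat r)"
proof -
  have "refl_on (Field r) r" "trans r"
    using assms by (auto simp: order_on_defs)
  then show ?thesis
    by (auto simp: category_def order_cat_def hom_def refl_on_def Field_def dest: transD)
qed

lemma category_pseudopullback:
  assumes B: "category B"
    and E: "\<And>j. j \<in> J \<Longrightarrow> category (E j)"
    and P: "\<And>j. j \<in> J \<Longrightarrow> is_functor (E j) B (P j)"
  shows "category (pseudopullback J E B P)"
proof -
  let ?C = "pseudopullback J E B P"
  have dc: "Dom ?C f \<in> Ob ?C \<and> Cod ?C f \<in> Ob ?C" if "f \<in> Ar ?C" for f
    using that by (auto simp: pseudopullback_def pp_ars_def)
  have ide: "Idn ?C a \<in> hom ?C a a" if a: "a \<in> Ob ?C" for a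
  proof -
    obtain b e i where [simp]: "a = (b, e, i)" by (cases a)
    have x: "(b, e, i) \<in> pp_obs J E B P" using a by (simp add: pseudopullback_def)
    have "FAr (P j) (Idn (E j) (e j)) \<cdot>\<^bsub>B\<^esub> i j = i j \<cdot>\<^bsub>B\<^esub> Idn B b" if j: "j \<in> J" for j
    proof -
      have "i j \<in> hom B b (FOb (P j) (e j))" "e j \<in> Ob (E j)"
        using x j by (auto simp: pp_obs_def PiE_iff)
      then show ?thesis using B P[OF j] by (simp add: category_def is_functor_def hom_def) metis
    qed
    moreover have "Idn B b \<in> hom B b b" using x B by (simp add: pp_obs_def category_def)
    moreover have "Idn (E j) (e j) \<in> hom (E j) (e j) (e j)" if j: "j \<in> J" for j
      using x E[OF j] j by (auto simp: pp_obs_def category_def PiE_iff)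
    ultimately show ?thesis using x
      by (simp add: hom_def[of ?C]) (simp add: pseudopullback_def pp_ars_def)
  qed
  have cmp: "g \<cdot>\<^bsub>?C\<^esub> f \<in> hom ?C (Dom ?C f) (Cod ?C g)"
    if f: "f \<in> Ar ?C" and g: "g \<in> Ar ?C" and fg: "Cod ?C f = Dom ?C g" for f g
  proof -
    obtain b e i y \<sigma> s where f1[simp]: "f = ((b, e, i), y, \<sigma>, s)"
      by (metis prod_cases6 prod.collapse)
    obtain y' b'' e'' i'' \<tau> t where g1[simp]: "g = (y', (b'', e'', i''), \<tau>, t)"
      by (metis prod.collapse)
    obtain b' e' i' where y'[simp]: "y' = (b', e', i')" by (cases y')
    have [simp]: "y = y'" using fg by (simp add: pseudopullback_def)
    have F: "((b, e, i), (b', e', i'), \<sigma>, s) \<in> pp_ars J E B P"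
     and G: "((b', e', i'), (b'', e'', i''), \<tau>, t) \<in> pp_ars J E B P"
      using f g by (auto simp: pseudopullback_def)
    have st: "\<sigma> \<in> hom B b b'" "\<tau> \<in> hom B b' b''" using F G by (auto simp: pp_ars_def)
    have nat: "FAr (P j) (t j \<cdot>\<^bsub>E j\<^esub> s j) \<cdot>\<^bsub>B\<^esub> i j = i'' j \<cdot>\<^bsub>B\<^esub> (\<tau> \<cdot>\<^bsub>B\<^esub> \<sigma>)"
      if j: "j \<in> J" for j
    proof -
      have s: "s j \<in> hom (E j) (e j) (e' j)" and t: "t j \<in> hom (E j) (e' j) (e'' j)"
        and i: "i j \<in> hom B b (FOb (P j) (e j))" and i': "i' j \<in> hom B b' (FOb (P j) (e' j))"
        and i'': "i'' j \<in> hom B b'' (FOb (P j) (e'' j))"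
        using F G j by (auto simp: pp_ars_def pp_obs_def PiE_iff)
      have ps: "FAr (P j) (s j) \<in> hom B (FOb (P j) (e j)) (FOb (P j) (e' j))"
        and pt: "FAr (P j) (t j) \<in> hom B (FOb (P j) (e' j)) (FOb (P j) (e'' j))"
        and pc: "FAr (P j) (t j \<cdot>\<^bsub>E j\<^esub> s j) = FAr (P j) (t j) \<cdot>\<^bsub>B\<^esub> FAr (P j) (s j)"
        using P[OF j] s t by (auto simp: is_functor_def hom_def)
      have sq: "FAr (P j) (s j) \<cdot>\<^bsub>B\<^esub> i j = i' j \<cdot>\<^bsub>B\<^esub> \<sigma>" "FAr (P j) (t j) \<cdot>\<^bsub>B\<^esub> i' j = i'' j \<cdot>\<^bsub>B\<^esub> \<tau>"
        using F G j by (auto simp: pp_ars_def)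
      have assoc: "\<And>f g h. f \<in> Ar B \<Longrightarrow> g \<in> Ar B \<Longrightarrow> h \<in> Ar B \<Longrightarrow> Cod B f = Dom B g \<Longrightarrow>
          Cod B g = Dom B h \<Longrightarrow> h \<cdot>\<^bsub>B\<^esub> (g \<cdot>\<^bsub>B\<^esub> f) = (h \<cdot>\<^bsub>B\<^esub> g) \<cdot>\<^bsub>B\<^esub> f"
        using B by (simp add: category_def)
      have "FAr (P j) (t j) \<cdot>\<^bsub>B\<^esub> FAr (P j) (s j) \<cdot>\<^bsub>B\<^esub> i j = FAr (P j) (t j) \<cdot>\<^bsub>B\<^esub> (i' j \<cdot>\<^bsub>B\<^esub> \<sigma>)"
        using assoc[of "i j" "FAr (P j) (s j)" "FAr (P j) (t j)"] sq i ps pt by (simp add: hom_def)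
      also have "\<dots> = (i'' j \<cdot>\<^bsub>B\<^esub> \<tau>) \<cdot>\<^bsub>B\<^esub> \<sigma>"
        using assoc[of \<sigma> "i' j" "FAr (P j) (t j)"] sq i' st pt by (simp add: hom_def)
      also have "\<dots> = i'' j \<cdot>\<^bsub>B\<^esub> (\<tau> \<cdot>\<^bsub>B\<^esub> \<sigma>)"
        using assoc[of \<sigma> \<tau> "i'' j"] i'' st by (simp add: hom_def)
      finally show ?thesis by (simp add: pc)
    qed
    have "t j \<cdot>\<^bsub>E j\<^esub> s j \<in> hom (E j) (e j) (e'' j)" if j: "j \<in> J" for j
    proof -
      have "s j \<in> hom (E j) (e j) (e' j)" "t j \<in> hom (E j) (e' j) (e'' j)"
        using F G j by (auto simp: pp_ars_def PiE_iff)
      then show ?thesis using E[OF j] by (simp add: category_def hom_def)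
    qed
    moreover have "\<tau> \<cdot>\<^bsub>B\<^esub> \<sigma> \<in> hom B b b''" using st B by (simp add: category_def hom_def)
    moreover have "(b, e, i) \<in> pp_obs J E B P" "(b'', e'', i'') \<in> pp_obs J E B P"
      using F G by (auto simp: pp_ars_def)
    ultimately show ?thesis using nat
      by (simp add: hom_def[of ?C]) (simp add: pseudopullback_def pp_ars_def)
  qed
  have unitB: "f \<cdot>\<^bsub>B\<^esub> Idn B x = f \<and> Idn B y \<cdot>\<^bsub>B\<^esub> f = f" if "f \<in> hom B x y" for f x y
    using that B by (auto simp: category_def hom_def)
  have unitE: "f \<cdot>\<^bsub>E j\<^esub> Idn (E j) x = f \<and> Idn (E j) y \<cdot>\<^bsub>E j\<^esub> f = f"
    if "j \<in> J" "f \<in> hom (E j) x y" for f x y j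
    using that(2) E[OF that(1)] by (auto simp: category_def hom_def)
  have unit: "f \<cdot>\<^bsub>?C\<^esub> Idn ?C (Dom ?C f) = f \<and> Idn ?C (Cod ?C f) \<cdot>\<^bsub>?C\<^esub> f = f"
    if "f \<in> Ar ?C" for f
    using that
    by (auto simp: pseudopullback_def pp_ars_def PiE_iff unitB extensional_def fun_eq_iff)
      (metis unitE)+
  have assocB: "h \<cdot>\<^bsub>B\<^esub> (g \<cdot>\<^bsub>B\<^esub> f) = (h \<cdot>\<^bsub>B\<^esub> g) \<cdot>\<^bsub>B\<^esub> f"
    if "f \<in> hom B w x" "g \<in> hom B x y" "h \<in> hom B y z" for f g h w x y z
    using that B by (simp add: category_def hom_def)
  have assocE: "h \<cdot>\<^bsub>E j\<^esub> (g \<cdot>\<^bsub>E j\<^esub> f) = (h \<cdot>\<^bsub>E j\<^esub> g) \<cdot>\<^bsub>E j\<^esub> f"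
    if "j \<in> J" "f \<in> hom (E j) w x" "g \<in> hom (E j) x y" "h \<in> hom (E j) y z" for f g h w x y z j
    using that(2-) E[OF that(1)] by (simp add: category_def hom_def)
  have assoc: "h \<cdot>\<^bsub>?C\<^esub> (g \<cdot>\<^bsub>?C\<^esub> f) = (h \<cdot>\<^bsub>?C\<^esub> g) \<cdot>\<^bsub>?C\<^esub> f"
    if "f \<in> Ar ?C" "g \<in> Ar ?C" "h \<in> Ar ?C" "Cod ?C f = Dom ?C g" "Cod ?C g = Dom ?C h" for f g h
    using that
    by (auto simp: pseudopullback_def pp_ars_def PiE_iff fun_eq_iff intro: assocB)
      (metis assocE)
  show ?thesis unfolding category_def using dc ide cmp unit assoc by blast
qed

lemma is_functor_pp_proj: "is_functor (pseudopullback J E B P) B pp_proj"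
  by (auto simp: is_functor_def pp_proj_def pseudopullback_def pp_ars_def pp_obs_def hom_def)

end

theory Submission
  imports Defs "HOL-Library.Nat_Bijection"
begin

text \<open>
  Let \<open>(b\<^sub>0, (e j), (i\<^sub>0 j))\<close> be an object of the pseudopullback and \<open>\<epsilon> : b\<^sub>0 \<rightarrow> b 0\<close>.  The displacements of
  the components \<open>e j\<close> live over different objects of the base, so that they must be brought together
  again, and this is done by iteration.  Put \<open>e 0 j = e j\<close> and
  \<open>\<beta> 0 j = \<epsilon> \<circ> (i\<^sub>0 j)\<inverse> : P j (e 0 j) \<rightarrow> b 0\<close>.  Displace each \<open>e n j\<close> along \<open>\<beta> n j\<close>, with universal
  maps \<open>u n j : b n \<rightarrow> P j (e (n + 1) j)\<close>, and let \<open>b (n + 1)\<close> be the wide pushout of the \<open>u n j\<close> over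
  \<open>j\<close>, with legs \<open>\<beta> (n + 1) j\<close>.  The sequences \<open>b n\<close> and \<open>P j (e n j)\<close> interleave.  Hence the colimit
  \<open>c\<close> of the \<open>b n\<close> is isomorphic to \<open>P j (l j)\<close>, where \<open>l j\<close> is the colimit of the \<open>e n j\<close>, which exists
  and is preserved because \<open>P j\<close> creates filtered colimits.  So \<open>c\<close> and the \<open>l j\<close> form an object of the
  pseudopullback.  It is the displacement, with universal map the leg \<open>b 0 \<rightarrow> c\<close>: at each stage the
  universal properties of the displacements and of the wide pushout extend a given pair of arrows
  uniquely (\<open>tower_colimit_desc\<close>, \<open>tower_colimit_unique\<close>, \<open>displacement_pseudopullback\<close>).

  Left perfectness is proved along the way.  Let \<open>W\<close> be a class closed under transfinite composition
  and cobase change, such that displacements along arrows in \<open>W\<close> can be chosen with universal maps in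
  \<open>W\<close>.  If the \<open>\<beta> n j\<close> lie in \<open>W\<close>, then so do the \<open>u n j\<close>.  The leg \<open>b n \<rightarrow> b (n + 1)\<close> of the wide pushout
  is a transfinite composite of cobase changes of the \<open>u n j\<close> (\<open>wide_pushout_leg_in_underS\<close>), and
  \<open>\<beta> (n + 1) j\<close> is a cobase change of such a leg, that of the wide pushout of the other arrows
  (\<open>wide_pushout_legs_in\<close>).  Finally \<open>b 0 \<rightarrow> c\<close> is a composite of an \<open>\<omega>\<close>-sequence in \<open>W\<close>
  (\<open>seq_composite_in\<close>).  The existence of displacements is the case in which \<open>W\<close> consists of all arrows.
\<close>

section \<open>Arrows, functors and isomorphisms\<close>

locale cat_ctx =
  fixes C :: "('o, 'm) cat" (structure)
  assumes category: "category C"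
begin

lemma dom_cod_ob: "f \<in> Ar C \<Longrightarrow> Dom C f \<in> Ob C" "f \<in> Ar C \<Longrightarrow> Cod C f \<in> Ob C"
  using category by (auto simp: category_def)

lemma idn_hom: "a \<in> Ob C \<Longrightarrow> Idn C a \<in> hom C a a"
  using category by (auto simp: category_def)

lemma cmp_hom: "f \<in> hom C a b \<Longrightarrow> g \<in> hom C b c \<Longrightarrow> g \<cdot> f \<in> hom C a c"
  using category by (auto simp: category_def hom_def)

lemma hom_obs: "f \<in> hom C a b \<Longrightarrow> a \<in> Ob C" "f \<in> hom C a b \<Longrightarrow> b \<in> Ob C"
  using dom_cod_ob by (auto simp: hom_def)

lemma idn_right: "f \<in> hom C a b \<Longrightarrow> f \<cdot> Idn C a = f"
  using category by (auto simp: category_def hom_def)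

lemma idn_left: "f \<in> hom C a b \<Longrightarrow> Idn C b \<cdot> f = f"
  using category by (auto simp: category_def hom_def)

lemma assoc:
  "f \<in> hom C a b \<Longrightarrow> g \<in> hom C b c \<Longrightarrow> h \<in> hom C c d \<Longrightarrow> (h \<cdot> g) \<cdot> f = h \<cdot> (g \<cdot> f)"
  using category by (simp add: category_def hom_def)

lemma iso_inverse:
  assumes "iso_in C f" "f \<in> hom C a b"
  obtains g where "g \<in> hom C b a" "g \<cdot> f = Idn C a" "f \<cdot> g = Idn C b"
  using assms by (auto simp: iso_in_def hom_def)

lemma isoI:
  assumes "f \<in> hom C a b" "g \<in> hom C b a" "g \<cdot> f = Idn C a" "f \<cdot> g = Idn C b"
  shows "iso_in C f"
  using assms by (auto simp: iso_in_def hom_def)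

lemma iso_cancel_left:
  assumes "iso_in C f" "f \<in> hom C a b" "x \<in> hom C d a" "y \<in> hom C d a" "f \<cdot> x = f \<cdot> y"
  shows "x = y"
proof -
  obtain g where g: "g \<in> hom C b a" "g \<cdot> f = Idn C a"
    using iso_inverse[OF assms(1,2)] by metis
  have "(g \<cdot> f) \<cdot> x = (g \<cdot> f) \<cdot> y"
    using assoc[OF assms(3,2) g(1)] assoc[OF assms(4,2) g(1)] assms(5) by simp
  then show ?thesis using g idn_left assms by simp
qed

lemma iso_cancel_right:
  assumes "iso_in C f" "f \<in> hom C a b" "x \<in> hom C b d" "y \<in> hom C b d" "x \<cdot> f = y \<cdot> f"
  shows "x = y"
proof -
  obtain g where g: "g \<in> hom C b a" "f \<cdot> g = Idn C b"
    using iso_inverse[OF assms(1,2)] by metis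
  have "x \<cdot> (f \<cdot> g) = y \<cdot> (f \<cdot> g)"
    using assoc[OF g(1) assms(2,3)] assoc[OF g(1) assms(2,4)] assms(5) by simp
  then show ?thesis using g idn_right assms by simp
qed

end

lemma functor_hom:
  "is_functor C D F \<Longrightarrow> f \<in> hom C a b \<Longrightarrow> FAr F f \<in> hom D (FOb F a) (FOb F b)"
  by (auto simp: is_functor_def hom_def)

lemma functor_idn: "is_functor C D F \<Longrightarrow> a \<in> Ob C \<Longrightarrow> FAr F (Idn C a) = Idn D (FOb F a)"
  by (auto simp: is_functor_def)

lemma functor_cmp:
  "is_functor C D F \<Longrightarrow> f \<in> hom C a b \<Longrightarrow> g \<in> hom C b c \<Longrightarrow>
    FAr F (g \<cdot>\<^bsub>C\<^esub> f) = FAr F g \<cdot>\<^bsub>D\<^esub> FAr F f"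
  by (auto simp: is_functor_def hom_def)


section \<open>Pushouts and wide pushouts\<close>

context cat_ctx
begin

lemma is_pushout_sym: "is_pushout C f g g' f' \<Longrightarrow> is_pushout C g f f' g'"
  unfolding is_pushout_def by (simp (no_asm_simp)) (smt (verit, best))

lemma is_pushoutI:
  assumes "f \<in> hom C a b" "g \<in> hom C a c" "g' \<in> hom C b d" "f' \<in> hom C c d"
    and "g' \<cdot> f = f' \<cdot> g"
    and "\<And>x s t. s \<in> hom C b x \<Longrightarrow> t \<in> hom C c x \<Longrightarrow> s \<cdot> f = t \<cdot> g \<Longrightarrow>
      \<exists>!h. h \<in> hom C d x \<and> h \<cdot> g' = s \<and> h \<cdot> f' = t"
  shows "is_pushout C f g g' f'"
proof -
  have "f \<in> Ar C" "g \<in> Ar C" "g' \<in> Ar C" "f' \<in> Ar C"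
    "Dom C f = a" "Cod C f = b" "Dom C g = a" "Cod C g = c"
    "Dom C g' = b" "Cod C g' = d" "Dom C f' = c" "Cod C f' = d"
    using assms(1-4) by (auto simp: hom_def)
  then show ?thesis
    unfolding is_pushout_def using assms(5,6) by simp
qed

lemma wide_pushout_cocone:
  assumes "is_wide_pushout C K a f w m q"
  shows "w \<in> Ob C" "m \<in> hom C a w" "k \<in> K \<Longrightarrow> q k \<in> hom C (Cod C (f k)) w"
    "k \<in> K \<Longrightarrow> q k \<cdot> f k = m"
  using assms by (auto simp: is_wide_pushout_def wide_cocone_def)

lemma wide_pushout_unique:
  assumes "is_wide_pushout C K a f w m q" "\<And>k. k \<in> K \<Longrightarrow> f k \<in> hom C a (Cod C (f k))"
    and "h \<in> hom C w x" "h' \<in> hom C w x" "h \<cdot> m = h' \<cdot> m"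
    and "\<And>k. k \<in> K \<Longrightarrow> h \<cdot> q k = h' \<cdot> q k"
  shows "h = h'"
proof -
  note w = wide_pushout_cocone[OF assms(1)]
  have "wide_cocone C K a f x (h \<cdot> m) (\<lambda>k. h \<cdot> q k)"
    unfolding wide_cocone_def
    using w assms(2,3) cmp_hom hom_obs assoc by (metis (no_types, lifting))
  then have "\<exists>!k. k \<in> hom C w x \<and> k \<cdot> m = h \<cdot> m \<and> (\<forall>i\<in>K. k \<cdot> q i = h \<cdot> q i)"
    using assms(1) unfolding is_wide_pushout_def by blast
  then show ?thesis using assms by metis
qed

lemma wide_pushout_desc:
  assumes "is_wide_pushout C K a f w m q" "m' \<in> hom C a x"
    and "\<And>k. k \<in> K \<Longrightarrow> q' k \<in> hom C (Cod C (f k)) x"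
    and "\<And>k. k \<in> K \<Longrightarrow> q' k \<cdot> f k = m'"
  obtains h where "h \<in> hom C w x" "h \<cdot> m = m'" "\<And>k. k \<in> K \<Longrightarrow> h \<cdot> q k = q' k"
proof -
  have "wide_cocone C K a f x m' q'"
    unfolding wide_cocone_def using assms hom_obs by metis
  then have "\<exists>!k. k \<in> hom C w x \<and> k \<cdot> m = m' \<and> (\<forall>i\<in>K. k \<cdot> q i = q' i)"
    using assms(1) unfolding is_wide_pushout_def by blast
  with that show ?thesis by blast
qed

text \<open>Adjoining one arrow to the family is a pushout along that arrow.\<close>

lemma wide_pushout_insert:
  assumes w: "is_wide_pushout C K a f w m q"
    and w': "is_wide_pushout C (insert k K) a f w' m' q'"
    and k: "k \<notin> K"
    and f: "\<And>i. i \<in> insert k K \<Longrightarrow> f i \<in> hom C a (Cod C (f i))"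
    and h: "h \<in> hom C w w'" "h \<cdot> m = m'" "\<And>i. i \<in> K \<Longrightarrow> h \<cdot> q i = q' i"
  shows "is_pushout C (f k) m (q' k) h"
proof -
  note W = wide_pushout_cocone[OF w] and W' = wide_pushout_cocone[OF w']
  have fk: "f k \<in> hom C a (Cod C (f k))" and q'k: "q' k \<in> hom C (Cod C (f k)) w'"
    and q'f: "q' k \<cdot> f k = m'"
    using f W' by auto
  have fK: "f i \<in> hom C a (Cod C (f i))" if "i \<in> K" for i
    using f that by blast
  have "\<exists>!l. l \<in> hom C w' x \<and> l \<cdot> q' k = s \<and> l \<cdot> h = t"
    if s: "s \<in> hom C (Cod C (f k)) x" and t: "t \<in> hom C w x" and st: "s \<cdot> f k = t \<cdot> m" for x s t
  proof -
    define r where "r i = (if i = k then s else t \<cdot> q i)" for i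
    have "r i \<in> hom C (Cod C (f i)) x" if "i \<in> insert k K" for i
      using that s cmp_hom[OF W(3) t] by (cases "i = k") (auto simp: r_def)
    moreover have "r i \<cdot> f i = t \<cdot> m" if "i \<in> insert k K" for i
    proof (cases "i = k")
      case False
      then have i: "i \<in> K" using that by simp
      then show ?thesis using assoc[OF fK[OF i] W(3)[OF i] t] W(4) False by (simp add: r_def)
    qed (simp add: r_def st)
    ultimately obtain l where l: "l \<in> hom C w' x" "l \<cdot> m' = t \<cdot> m"
      "\<And>i. i \<in> insert k K \<Longrightarrow> l \<cdot> q' i = r i"
      using wide_pushout_desc[OF w' cmp_hom[OF W(2) t], of r] by metis
    have "(l \<cdot> h) \<cdot> q i = t \<cdot> q i" if i: "i \<in> K" for i
      using assoc[OF W(3)[OF i] h(1) l(1)] h(3)[OF i] l(3)[of i] i k by (auto simp: r_def)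
    moreover have "(l \<cdot> h) \<cdot> m = t \<cdot> m"
      using assoc[OF W(2) h(1) l(1)] h(2) l(2) by simp
    ultimately have "l \<cdot> h = t"
      using wide_pushout_unique[OF w fK cmp_hom[OF h(1) l(1)] t] by blast
    moreover have "l' = l"
      if l': "l' \<in> hom C w' x" "l' \<cdot> q' k = s" "l' \<cdot> h = t" for l'
    proof (rule wide_pushout_unique[OF w' f l'(1) l(1)])
      show "l' \<cdot> m' = l \<cdot> m'"
        using assoc[OF W(2) h(1) l'(1)] h(2) l(2) l'(3) by simp
      show "l' \<cdot> q' i = l \<cdot> q' i" if i: "i \<in> insert k K" for i
      proof (cases "i = k")
        case False
        then have i: "i \<in> K" using i by simp
        show ?thesis
          using assoc[OF W(3)[OF i] h(1) l'(1)] h(3)[OF i] l(3)[of i] i False l'(3)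
          by (simp add: r_def)
      qed (use l'(2) l(3)[of k] in \<open>simp add: r_def\<close>)
    qed
    moreover have "l \<cdot> q' k = s" using l(3)[of k] by (simp add: r_def)
    ultimately show ?thesis using l(1) by blast
  qed
  then show ?thesis
    using is_pushoutI[OF fk W(2) q'k h(1)] q'f h(2) by simp
qed

text \<open>Precomposing with an isomorphism is a cobase change along its inverse.\<close>

lemma is_pushout_iso:
  assumes f: "f \<in> hom C a b" and g: "g \<in> hom C a' a" "g' \<in> hom C a a'"
    "g' \<cdot> g = Idn C a'" "g \<cdot> g' = Idn C a"
  shows "is_pushout C f g' (Idn C b) (f \<cdot> g)"
proof -
  have b: "Idn C b \<in> hom C b b" using idn_hom hom_obs(2)[OF f] .
  have fg: "f \<cdot> g \<in> hom C a' b" using cmp_hom f g by blast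
  have "(f \<cdot> g) \<cdot> g' = f" using assoc[OF g(2,1) f] g(4) idn_right[OF f] by simp
  moreover have "\<exists>!h. h \<in> hom C b x \<and> h \<cdot> Idn C b = s \<and> h \<cdot> (f \<cdot> g) = t"
    if s: "s \<in> hom C b x" and t: "t \<in> hom C a' x" and st: "s \<cdot> f = t \<cdot> g'" for x s t
  proof -
    have "s \<cdot> (f \<cdot> g) = (t \<cdot> g') \<cdot> g" using assoc[OF g(1) f s] st by simp
    also have "\<dots> = t" using assoc[OF g(1,2) t] g(3) idn_right[OF t] by simp
    finally show ?thesis using s idn_right by metis
  qed
  ultimately show ?thesis
    using is_pushoutI[OF f g(2) b fg] idn_left[OF f] by simp
qed

end

text \<open>A set of cardinality below \<open>\<kappa>\<close> is enumerated by a proper initial segment of \<open>\<kappa>\<close>.\<close>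

lemma bij_betw_underS_of_ordLess:
  assumes "|J| <o \<kappa>"
  obtains t g where "t \<in> Field \<kappa>" "bij_betw g (underS \<kappa> t) J"
proof -
  have "Well_order \<kappa>" "Well_order |J|"
    using assms by (auto simp: ordLess_def)
  then obtain t where t: "t \<in> Field \<kappa>" "|J| =o Restr \<kappa> (underS \<kappa> t)"
    using assms ordLess_iff_ordIso_Restr by blast
  then obtain f where "iso |J| (Restr \<kappa> (underS \<kappa> t)) f"
    by (auto simp: ordIso_def)
  then have "bij_betw f (Field |J| ) (Field (Restr \<kappa> (underS \<kappa> t)))"
    by (simp add: iso_def)
  moreover have "Field (Restr \<kappa> (underS \<kappa> t)) = underS \<kappa> t"
    using \<open>Well_order \<kappa>\<close> by (intro Refl_Field_Restr2 Order_Relation.underS_Field) (simp add: order_on_defs)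
  ultimately have "bij_betw f J (underS \<kappa> t)" by (simp add: Field_card_of)
  then show ?thesis using that t(1) bij_betw_inv by blast
qed

context cat_ctx
begin

lemma wide_pushout_reindex:
  assumes g: "bij_betw g K J" and w: "is_wide_pushout C K a (f \<circ> g) w m q"
  shows "is_wide_pushout C J a f w m (q \<circ> inv_into K g)"
proof -
  have J: "J = g ` K" and inj: "inj_on g K" using g by (auto simp: bij_betw_def)
  have coc: "wide_cocone C J a f x m' q' \<longleftrightarrow> wide_cocone C K a (f \<circ> g) x m' (q' \<circ> g)" for x m' q'
    by (auto simp: wide_cocone_def J)
  have coc': "wide_cocone C K a (f \<circ> g) w m ((q \<circ> inv_into K g) \<circ> g)
      \<longleftrightarrow> wide_cocone C K a (f \<circ> g) w m q"
    by (simp add: wide_cocone_def inj)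
  have leg: "(\<forall>j\<in>J. h \<cdot> (q \<circ> inv_into K g) j = q' j) \<longleftrightarrow> (\<forall>k\<in>K. h \<cdot> q k = (q' \<circ> g) k)" for h q'
    by (simp add: J inj)
  show ?thesis
    using w unfolding is_wide_pushout_def coc coc' leg by blast
qed

text \<open>The index set of a small wide pushout may be taken in any type.\<close>

lemma small_wide_pushout:
  assumes \<kappa>: "has_small_wide_pushouts \<kappa> C" and J: "|J| <o \<kappa>"
    and f: "a \<in> Ob C" "\<And>j. j \<in> J \<Longrightarrow> f j \<in> hom C a (Cod C (f j))"
  obtains w m q where "is_wide_pushout C J a f w m q"
proof -
  obtain t g where g: "bij_betw g (underS \<kappa> t) J"
    using bij_betw_underS_of_ordLess[OF J] .
  then have "|underS \<kappa> t| =o |J|" using card_of_ordIso by blast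
  then have "|underS \<kappa> t| <o \<kappa>" using J ordIso_ordLess_trans by blast
  moreover have "(f \<circ> g) k \<in> Ar C \<and> Dom C ((f \<circ> g) k) = a" if "k \<in> underS \<kappa> t" for k
    using f(2)[of "g k"] g that by (auto simp: bij_betw_def hom_def)
  ultimately obtain w m q where "is_wide_pushout C (underS \<kappa> t) a (f \<circ> g) w m q"
    using \<kappa> f(1) unfolding has_small_wide_pushouts_def by blast
  then show ?thesis using that wide_pushout_reindex[OF g] by blast
qed

lemma wide_pushout_reindex':
  assumes g: "bij_betw g K J" and w: "is_wide_pushout C J a f w m q"
  shows "is_wide_pushout C K a (f \<circ> g) w m (q \<circ> g)"
proof -
  have J: "J = g ` K" and inj: "inj_on g K" using g by (auto simp: bij_betw_def)
  have coc: "wide_cocone C J a f w m q \<longleftrightarrow> wide_cocone C K a (f \<circ> g) w m (q \<circ> g)"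
    by (auto simp: wide_cocone_def J)
  have coc': "wide_cocone C K a (f \<circ> g) x m' q' \<longleftrightarrow>
      wide_cocone C J a f x m' (q' \<circ> inv_into K g)" for x m' q'
    by (simp add: wide_cocone_def J inj)
  have leg: "(\<forall>k\<in>K. h \<cdot> (q \<circ> g) k = q' k) \<longleftrightarrow> (\<forall>j\<in>J. h \<cdot> q j = (q' \<circ> inv_into K g) j)" for h q'
    by (simp add: J inj)
  show ?thesis
    using w unfolding is_wide_pushout_def coc coc' leg by blast
qed

lemma cofibration_class_cobase:
  "cofibration_class TYPE('u) C W \<Longrightarrow> is_pushout C f g g' f' \<Longrightarrow> f \<in> W \<Longrightarrow> f' \<in> W"
  unfolding cofibration_class_def closed_cobase_change_def by blast

lemma cofibration_class_cmp_iso: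
  assumes "cofibration_class TYPE('u) C W" "f \<in> W" "f \<in> hom C a b"
    and "iso_in C g" "g \<in> hom C a' a"
  shows "f \<cdot> g \<in> W"
proof -
  obtain g' where "g' \<in> hom C a a'" "g' \<cdot> g = Idn C a'" "g \<cdot> g' = Idn C a"
    using iso_inverse[OF assms(4,5)] .
  then show ?thesis
    using cofibration_class_cobase[OF assms(1) is_pushout_iso assms(2)] assms(3,5) by blast
qed

text \<open>A wide pushout of arrows indexed by an initial segment of a well-order is a transfinite
  composite: the wide pushouts of the proper initial segments form a continuous sequence whose
  successor steps are cobase changes of the given arrows.\<close>

lemma wide_pushout_leg_in_underS:
  fixes \<kappa> :: "'u rel"
  assumes \<kappa>: "Card_order \<kappa>" and B: "has_small_wide_pushouts \<kappa> C"
    and W: "cofibration_class TYPE('u) C W"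
    and t: "t \<in> Field \<kappa>" and w: "is_wide_pushout C (underS \<kappa> t) a f w m q"
    and f: "\<And>k. k \<in> underS \<kappa> t \<Longrightarrow> f k \<in> hom C a (Cod C (f k))"
    and fW: "\<And>k. k \<in> underS \<kappa> t \<Longrightarrow> f k \<in> W"
  shows "m \<in> W"
proof -
  have wo: "Well_order \<kappa>" using \<kappa> by (simp add: card_order_on_def)
  then have order: "Refl \<kappa>" "Relation.trans \<kappa>" "antisym \<kappa>" "Total \<kappa>" by (simp_all add: order_on_defs)
  have refl: "(i, i) \<in> \<kappa>" if "i \<in> Field \<kappa>" for i
    using order(1) that by (rule refl_onD)
  have trans: "(i, k) \<in> \<kappa>" if "(i, j) \<in> \<kappa>" "(j, k) \<in> \<kappa>" for i j k
    using order(2) that by (rule transD)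
  have antisym: "i = j" if "(i, j) \<in> \<kappa>" "(j, i) \<in> \<kappa>" for i j
    using order(3) that by (rule antisymD)
  have total: "(i, j) \<in> \<kappa> \<or> (j, i) \<in> \<kappa>" if "i \<in> Field \<kappa>" "j \<in> Field \<kappa>" for i j
    using order(4) refl that by (cases "i = j") (auto simp: total_on_def)
  define A where "A = under \<kappa> t"
  have A: "i \<in> A \<longleftrightarrow> (i, t) \<in> \<kappa>" for i by (simp add: A_def under_def)
  have AF: "A \<subseteq> Field \<kappa>" and tA: "t \<in> A" using refl[OF t] by (auto simp: A Field_def)
  have u: "i \<in> underS \<kappa> j \<longleftrightarrow> i \<noteq> j \<and> (i, j) \<in> \<kappa>" for i j by (simp add: underS_def)
  have usub: "underS \<kappa> i \<subseteq> underS \<kappa> j" if "(i, j) \<in> \<kappa>" for i j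
    using that trans antisym unfolding underS_def by blast
  have fi: "f k \<in> hom C a (Cod C (f k))" if "i \<in> A" "k \<in> underS \<kappa> i" for i k
    using f usub that A by blast
  have a: "a \<in> Ob C" using hom_obs(1) wide_pushout_cocone(2)[OF w] .
  have "\<exists>X. is_wide_pushout C (underS \<kappa> i) a f (fst X) (fst (snd X)) (snd (snd X)) \<and>
      (i = t \<longrightarrow> X = (w, m, q))" if i: "i \<in> A" for i
  proof (cases "i = t")
    case False
    have "|underS \<kappa> i| <o \<kappa>" using card_of_underS[OF \<kappa>] AF i by blast
    then obtain w' m' q' where "is_wide_pushout C (underS \<kappa> i) a f w' m' q'"
      using small_wide_pushout[OF B _ a] fi[OF i] by blast
    then show ?thesis using False by (intro exI[of _ "(w', m', q')"]) simp
  qed (use w in simp)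
  then have "\<forall>i\<in>A. \<exists>X. is_wide_pushout C (underS \<kappa> i) a f (fst X) (fst (snd X)) (snd (snd X)) \<and>
      (i = t \<longrightarrow> X = (w, m, q))" by (rule ballI)
  from bchoice[OF this] obtain X where "\<forall>i\<in>A. is_wide_pushout C (underS \<kappa> i) a f
      (fst (X i)) (fst (snd (X i))) (snd (snd (X i))) \<and> (i = t \<longrightarrow> X i = (w, m, q))"
    by (elim exE)
  then obtain xo xm xq where X: "\<And>i. i \<in> A \<Longrightarrow> is_wide_pushout C (underS \<kappa> i) a f (xo i) (xm i) (xq i)"
    and Xt: "xo t = w" "xm t = m" "xq t = q"
    using that[of "\<lambda>i. fst (X i)" "\<lambda>i. fst (snd (X i))" "\<lambda>i. snd (snd (X i))"] tA by simp
  note co = wide_pushout_cocone[OF X]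
  \<comment> \<open>\<open>xo i\<close> is the wide pushout over the elements below \<open>i\<close>, and \<open>T i j\<close> is the comparison arrow.\<close>
  define T where "T i j = (THE h. h \<in> hom C (xo i) (xo j) \<and> h \<cdot> xm i = xm j \<and>
      (\<forall>k\<in>underS \<kappa> i. h \<cdot> xq i k = xq j k))" for i j
  have Tunique: "h = h'"
    if "i \<in> A" "h \<in> hom C (xo i) x" "h' \<in> hom C (xo i) x" "h \<cdot> xm i = h' \<cdot> xm i"
      "\<And>k. k \<in> underS \<kappa> i \<Longrightarrow> h \<cdot> xq i k = h' \<cdot> xq i k" for i x h h'
    using wide_pushout_unique[OF X[OF that(1)] fi[OF that(1)] that(2-4)] that(5) by blast
  have "T i j \<in> hom C (xo i) (xo j) \<and> T i j \<cdot> xm i = xm j \<and>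
      (\<forall>k\<in>underS \<kappa> i. T i j \<cdot> xq i k = xq j k)" if ij: "(i, j) \<in> \<kappa>" "j \<in> A" for i j
  proof -
    have i: "i \<in> A" using ij trans A by blast
    obtain h where h: "h \<in> hom C (xo i) (xo j)" "h \<cdot> xm i = xm j"
      "\<And>k. k \<in> underS \<kappa> i \<Longrightarrow> h \<cdot> xq i k = xq j k"
      using wide_pushout_desc[OF X[OF i] co(2)[OF ij(2)], of "xq j"] co(3,4)[OF ij(2)] usub[OF ij(1)]
      by blast
    show ?thesis
      unfolding T_def
      by (rule theI[of _ h]) (use h Tunique[OF i] in auto)
  qed
  then have T: "T i j \<in> hom C (xo i) (xo j)" "T i j \<cdot> xm i = xm j"
      "k \<in> underS \<kappa> i \<Longrightarrow> T i j \<cdot> xq i k = xq j k" if "(i, j) \<in> \<kappa>" "j \<in> A" for i j k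
    using that by blast+
  have below: "i \<in> A" if "(i, j) \<in> \<kappa>" "j \<in> A" for i j using that trans A by blast
  have Tid: "T i i = Idn C (xo i)" if i: "i \<in> A" for i
  proof (rule Tunique[OF i])
    have ii: "(i, i) \<in> \<kappa>" using refl i AF by blast
    show "T i i \<in> hom C (xo i) (xo i)" using T(1)[OF ii i] .
    show "Idn C (xo i) \<in> hom C (xo i) (xo i)" using idn_hom co(1)[OF i] .
    show "T i i \<cdot> xm i = Idn C (xo i) \<cdot> xm i"
      using T(2)[OF ii i] idn_left[OF co(2)[OF i]] by simp
    show "T i i \<cdot> xq i k = Idn C (xo i) \<cdot> xq i k" if "k \<in> underS \<kappa> i" for k
      using T(3)[OF ii i that] idn_left[OF co(3)[OF i that]] by simp
  qed
  have Tcmp: "T j k \<cdot> T i j = T i k" if ij: "(i, j) \<in> \<kappa>" and jk: "(j, k) \<in> \<kappa>" and k: "k \<in> A" for i j k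
  proof (rule Tunique)
    have ik: "(i, k) \<in> \<kappa>" using trans ij jk by blast
    have j: "j \<in> A" using below jk k by blast
    show i: "i \<in> A" using below ij j by blast
    show "T j k \<cdot> T i j \<in> hom C (xo i) (xo k)" using cmp_hom T(1) ij jk j k by blast
    show "T i k \<in> hom C (xo i) (xo k)" using T(1)[OF ik k] .
    show "(T j k \<cdot> T i j) \<cdot> xm i = T i k \<cdot> xm i"
      using assoc[OF co(2)[OF i] T(1)[OF ij j] T(1)[OF jk k]] T(2) ij jk ik j k by simp
    show "(T j k \<cdot> T i j) \<cdot> xq i l = T i k \<cdot> xq i l" if l: "l \<in> underS \<kappa> i" for l
    proof -
      have l': "l \<in> underS \<kappa> j" using usub[OF ij] l by blast
      show ?thesis
        using assoc[OF co(3)[OF i l] T(1)[OF ij j] T(1)[OF jk k]] T(3)[OF ij j l] T(3)[OF jk k l']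
          T(3)[OF ik k l] by simp
    qed
  qed
  define r where "r = Restr \<kappa> A"
  have r: "(i, j) \<in> r \<longleftrightarrow> (i, j) \<in> \<kappa> \<and> j \<in> A" for i j using below by (auto simp: r_def)
  have Fr: "Field r = A"
  proof (intro equalityI subsetI)
    show "i \<in> A" if "i \<in> Field r" for i using that r below unfolding Field_def by blast
    show "i \<in> Field r" if "i \<in> A" for i using that r refl AF by (meson FieldI1 subsetD)
  qed
  have wor: "Well_order r" unfolding r_def using wo Well_order_Restr by blast
  have ur: "underS r j = underS \<kappa> j" if "j \<in> A" for j
    using that by (auto simp: underS_def r)
  define F where "F = \<lparr> FOb = xo, FAr = (\<lambda>(i, j). T i j) \<rparr>"
  have Ffun: "is_functor (order_cat r) C F"
    using co(1) Tid T(1) Tcmp by (auto simp: is_functor_def order_cat_def F_def Fr r hom_def)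
  have step: "T i j \<in> W" if c: "covers r i j" for i j
  proof -
    have ij: "(i, j) \<in> \<kappa>" "j \<in> A" "i \<noteq> j" and i: "i \<in> A"
      using c below by (auto simp: covers_def r)
    have "underS \<kappa> j = insert i (underS \<kappa> i)"
    proof -
      have "k = i \<or> k \<in> underS \<kappa> i" if k: "k \<in> underS \<kappa> j" for k
      proof -
        have "(k, i) \<in> \<kappa> \<or> (i, k) \<in> \<kappa>" using total below k ij i AF u by blast
        moreover have "k = i" if "(i, k) \<in> \<kappa>"
          using c that k ij below by (auto simp: covers_def r u)
        ultimately show ?thesis by (auto simp: u)
      qed
      moreover have "i \<in> underS \<kappa> j" using ij by (simp add: u)
      ultimately show ?thesis using usub[OF ij(1)] by blast
    qed
    then have "is_pushout C (f i) (xm i) (xq j i) (T i j)"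
      using wide_pushout_insert[OF X[OF i], of i "xo j" "xm j" "xq j" "T i j"] X[OF ij(2)]
        fi[OF ij(2)] T ij by (simp add: u)
    moreover have "f i \<in> W" using fW ij usub A u by blast
    ultimately show ?thesis using cofibration_class_cobase[OF W] by blast
  qed
  have limit: "is_colimit (order_cat (Restr r (underS r j))) C F (xo j) (\<lambda>i. T i j)"
    if lim: "limit_elem r j" for j
  proof -
    have j: "j \<in> A" and ne: "underS \<kappa> j \<noteq> {}" and nc: "\<And>i. \<not> covers r i j"
      using lim ur by (auto simp: limit_elem_def Fr)
    let ?I = "order_cat (Restr r (underS r j))"
    have memA: "i \<in> A" and memj: "(i, j) \<in> \<kappa>" if "i \<in> underS \<kappa> j" for i
      using that below j by (auto simp: u)
    have "(i, k) \<in> Ar ?I \<longleftrightarrow> (i, k) \<in> \<kappa> \<and> k \<in> underS \<kappa> j" for i k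
    proof -
      have "(i, k) \<in> Ar ?I \<longleftrightarrow> (i, k) \<in> \<kappa> \<and> k \<in> A \<and> i \<in> underS \<kappa> j \<and> k \<in> underS \<kappa> j"
        by (auto simp: order_cat_def ur[OF j] r)
      then show ?thesis using memA[of k] memj[of k] usub[of k j] u[of i k] by blast
    qed
    then have Ir: "Ar ?I = {(i, k). (i, k) \<in> \<kappa> \<and> k \<in> underS \<kappa> j}" by blast
    have Io: "Ob ?I = underS \<kappa> j"
    proof (intro equalityI subsetI)
      have Fld: "Ob ?I = Field (Ar ?I)" by (simp add: order_cat_def)
      show "i \<in> underS \<kappa> j" if "i \<in> Ob ?I" for i
        using that usub memj unfolding Fld Ir Field_def by (auto simp: u dest: trans antisym)
      show "i \<in> Ob ?I" if i: "i \<in> underS \<kappa> j" for i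
        using refl[of i] memA[OF i] AF i unfolding Fld Ir by (intro FieldI1[of i i]) auto
    qed
    have Id: "Dom ?I = fst" "Cod ?I = snd" by (simp_all add: order_cat_def)
    have coc: "is_cocone ?I C F x \<nu> \<longleftrightarrow> x \<in> Ob C \<and> (\<forall>i\<in>underS \<kappa> j. \<nu> i \<in> hom C (xo i) x) \<and>
        (\<forall>i k. (i, k) \<in> \<kappa> \<longrightarrow> k \<in> underS \<kappa> j \<longrightarrow> \<nu> k \<cdot> T i k = \<nu> i)" for x \<nu>
      unfolding is_cocone_def Io Ir Id by (auto simp: F_def)
    have "\<exists>!h. h \<in> hom C (xo j) x \<and> (\<forall>i\<in>underS \<kappa> j. h \<cdot> T i j = \<nu> i)"
      if \<nu>: "\<And>i. i \<in> underS \<kappa> j \<Longrightarrow> \<nu> i \<in> hom C (xo i) x"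
        "\<And>i k. (i, k) \<in> \<kappa> \<Longrightarrow> k \<in> underS \<kappa> j \<Longrightarrow> \<nu> k \<cdot> T i k = \<nu> i" for x \<nu>
    proof -
      have bound: "\<exists>i\<in>underS \<kappa> j. k \<in> underS \<kappa> i" if k: "k \<in> underS \<kappa> j" for k
        using nc[of k] k j by (auto simp: covers_def r u dest: antisym)
      \<comment> \<open>The composites of \<open>\<nu> i\<close> with the legs of the wide pushouts do not depend on \<open>i\<close>.\<close>
      have indep: "\<nu> i \<cdot> xm i = \<nu> i' \<cdot> xm i' \<and>
          (\<forall>k \<in> underS \<kappa> i. \<nu> i \<cdot> xq i k = \<nu> i' \<cdot> xq i' k)"
        if i': "i' \<in> underS \<kappa> j" and le: "(i, i') \<in> \<kappa>" for i i'
      proof -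
        have A': "i' \<in> A" "i \<in> A" using memA[OF i'] le below by blast+
        have "\<nu> i' \<cdot> xm i' = (\<nu> i' \<cdot> T i i') \<cdot> xm i"
          using assoc[OF co(2)[OF A'(2)] T(1)[OF le A'(1)] \<nu>(1)[OF i']] T(2)[OF le A'(1)] by simp
        moreover have "\<nu> i' \<cdot> xq i' k = (\<nu> i' \<cdot> T i i') \<cdot> xq i k" if k: "k \<in> underS \<kappa> i" for k
          using assoc[OF co(3)[OF A'(2) k] T(1)[OF le A'(1)] \<nu>(1)[OF i']] T(3)[OF le A'(1) k] by simp
        ultimately show ?thesis using \<nu>(2)[OF le i'] by simp
      qed
      have tot: "(i, i') \<in> \<kappa> \<or> (i', i) \<in> \<kappa>" if "i \<in> underS \<kappa> j" "i' \<in> underS \<kappa> j" for i i'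
        using that total memA AF by blast
      obtain i0 where i0: "i0 \<in> underS \<kappa> j" using ne by blast
      define m' where "m' = \<nu> i0 \<cdot> xm i0"
      have m': "\<nu> i \<cdot> xm i = m'" if "i \<in> underS \<kappa> j" for i
        using tot[OF that i0] indep that i0 unfolding m'_def by metis
      obtain d where d: "\<And>k. k \<in> underS \<kappa> j \<Longrightarrow> d k \<in> underS \<kappa> j \<and> k \<in> underS \<kappa> (d k)"
        using bound bchoice[of "underS \<kappa> j"] by metis
      \<comment> \<open>As \<open>j\<close> is a limit, every \<open>k\<close> below \<open>j\<close> is below some \<open>d k\<close> below \<open>j\<close>.\<close>
      define s where "s k = \<nu> (d k) \<cdot> xq (d k) k" for k
      have s: "\<nu> i \<cdot> xq i k = s k" if "i \<in> underS \<kappa> j" "k \<in> underS \<kappa> i" for i k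
      proof -
        have k: "k \<in> underS \<kappa> j" using that memj usub by blast
        show ?thesis using tot[OF that(1), of "d k"] indep d[OF k] that unfolding s_def by metis
      qed
      have mh: "m' \<in> hom C a x"
        unfolding m'_def using cmp_hom co(2) memA i0 \<nu>(1) by blast
      have sh: "s k \<in> hom C (Cod C (f k)) x" if "k \<in> underS \<kappa> j" for k
        unfolding s_def using d[OF that] cmp_hom co(3) memA \<nu>(1) by blast
      have "s k \<cdot> f k = m'" if k: "k \<in> underS \<kappa> j" for k
      proof -
        have d': "d k \<in> underS \<kappa> j" "k \<in> underS \<kappa> (d k)" using d[OF k] by auto
        note dA = memA[OF d'(1)]
        show ?thesis
          unfolding s_def using m'[OF d'(1)]
            assoc[OF fi[OF j k] co(3)[OF dA d'(2)] \<nu>(1)[OF d'(1)]] co(4)[OF dA d'(2)] by simp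
      qed
      then obtain h where h: "h \<in> hom C (xo j) x" "h \<cdot> xm j = m'"
        "\<And>k. k \<in> underS \<kappa> j \<Longrightarrow> h \<cdot> xq j k = s k"
        using wide_pushout_desc[OF X[OF j] mh, of s] sh by metis
      have hT: "(g \<cdot> T i j) \<cdot> xm i = g \<cdot> xm j"
          "k \<in> underS \<kappa> i \<Longrightarrow> (g \<cdot> T i j) \<cdot> xq i k = g \<cdot> xq j k"
        if i: "i \<in> underS \<kappa> j" and g: "g \<in> hom C (xo j) x" for g i k
        using assoc[OF co(2)[OF memA[OF i]] T(1)[OF memj[OF i] j] g]
          assoc[OF co(3)[OF memA[OF i]] T(1)[OF memj[OF i] j] g] T(2,3)[OF memj[OF i] j] by simp_all
      have "h \<cdot> T i j = \<nu> i" if i: "i \<in> underS \<kappa> j" for i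
      proof (rule Tunique[OF memA[OF i] _ \<nu>(1)[OF i]])
        show "h \<cdot> T i j \<in> hom C (xo i) x" using cmp_hom[OF T(1)[OF memj[OF i] j] h(1)] .
        show "(h \<cdot> T i j) \<cdot> xm i = \<nu> i \<cdot> xm i" using hT(1)[OF i h(1)] h(2) m'[OF i] by simp
        show "(h \<cdot> T i j) \<cdot> xq i k = \<nu> i \<cdot> xq i k" if k: "k \<in> underS \<kappa> i" for k
          using hT(2)[OF i h(1) k] s[OF i k] h(3)[of k] k usub[OF memj[OF i]] by auto
      qed
      moreover have "h' = h" if h': "h' \<in> hom C (xo j) x" "\<forall>i\<in>underS \<kappa> j. h' \<cdot> T i j = \<nu> i" for h'
      proof (rule Tunique[OF j h'(1) h(1)])
        show "h' \<cdot> xm j = h \<cdot> xm j"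
          using hT(1)[OF i0 h'(1)] h' i0 h(2) m'_def by simp
        show "h' \<cdot> xq j k = h \<cdot> xq j k" if k: "k \<in> underS \<kappa> j" for k
          using hT(2)[OF _ h'(1), of "d k" k] h' d[OF k] h(3)[OF k] s_def by simp
      qed
      ultimately show ?thesis using h(1) by blast
    qed
    moreover have "is_cocone ?I C F (xo j) (\<lambda>i. T i j)"
      unfolding coc using co(1)[OF j] T(1)[OF memj j] Tcmp[OF _ memj j] by simp
    ultimately show ?thesis
      unfolding is_colimit_def coc Io by blast
  qed
  have "transfinite_sequence C W r F"
    unfolding transfinite_sequence_def
    using wor Fr tA Ffun step limit by (auto simp: F_def)
  moreover have "is_colimit (order_cat r) C F w (\<lambda>i. T i t)"
  proof -
    have coc: "is_cocone (order_cat r) C F x \<nu> \<longleftrightarrow> x \<in> Ob C \<and> (\<forall>i\<in>A. \<nu> i \<in> hom C (xo i) x) \<and>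
        (\<forall>i k. (i, k) \<in> \<kappa> \<longrightarrow> k \<in> A \<longrightarrow> \<nu> k \<cdot> T i k = \<nu> i)" for x \<nu>
    proof -
      have "Ar (order_cat r) = {(i, k). (i, k) \<in> \<kappa> \<and> k \<in> A}"
        using r by (auto simp: order_cat_def)
      moreover have "Ob (order_cat r) = A" "Dom (order_cat r) = fst" "Cod (order_cat r) = snd"
        by (simp_all add: order_cat_def Fr)
      ultimately show ?thesis unfolding is_cocone_def by (auto simp: F_def)
    qed
    have "\<exists>!h. h \<in> hom C w x \<and> (\<forall>i\<in>A. h \<cdot> T i t = \<nu> i)"
      if \<nu>: "\<And>i. i \<in> A \<Longrightarrow> \<nu> i \<in> hom C (xo i) x"
        "\<And>i k. (i, k) \<in> \<kappa> \<Longrightarrow> k \<in> A \<Longrightarrow> \<nu> k \<cdot> T i k = \<nu> i" for x \<nu>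
    proof (rule ex1I[of _ "\<nu> t"])
      show "\<nu> t \<in> hom C w x \<and> (\<forall>i\<in>A. \<nu> t \<cdot> T i t = \<nu> i)"
        using \<nu> tA Xt A by auto
      show "h = \<nu> t" if "h \<in> hom C w x \<and> (\<forall>i\<in>A. h \<cdot> T i t = \<nu> i)" for h
        using that Tid[OF tA] tA idn_right[of h w x] Xt by auto
    qed
    moreover have "is_cocone (order_cat r) C F w (\<lambda>i. T i t)"
      unfolding coc using co(1)[OF tA] T(1) Tcmp tA A Xt by metis
    ultimately show ?thesis
      unfolding is_colimit_def coc by (simp add: order_cat_def Fr)
  qed
  moreover obtain z where z: "z \<in> A" "underS \<kappa> z = {}"
  proof -
    have "wf (\<kappa> - Id)" using wo by (simp add: well_order_on_def)
    then obtain z where z: "z \<in> A" "\<And>y. (y, z) \<in> \<kappa> - Id \<Longrightarrow> y \<notin> A"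
      using tA wfE_min by metis
    have "underS \<kappa> z = {}" using z below u by blast
    then show ?thesis using that z(1) by blast
  qed
  ultimately have TW: "T z t \<in> W"
    using W unfolding cofibration_class_def closed_transfinite_composition_def
    using Fr ur by blast
  have zt: "(z, t) \<in> \<kappa>" using z A by simp
  \<comment> \<open>The bottom of the sequence is the wide pushout of the empty family.\<close>
  obtain g where g: "g \<in> hom C (xo z) a" "g \<cdot> xm z = Idn C a"
    using wide_pushout_desc[OF X[OF z(1)] idn_hom[OF a]] z(2) by blast
  have "xm z \<cdot> g = Idn C (xo z)"
  proof (rule Tunique[OF z(1)])
    show "xm z \<cdot> g \<in> hom C (xo z) (xo z)" using cmp_hom g(1) co(2)[OF z(1)] by blast
    show "Idn C (xo z) \<in> hom C (xo z) (xo z)" using idn_hom co(1)[OF z(1)] .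
    show "(xm z \<cdot> g) \<cdot> xm z = Idn C (xo z) \<cdot> xm z"
      using assoc[OF co(2)[OF z(1)] g(1) co(2)[OF z(1)]] g(2)
        idn_left[OF co(2)[OF z(1)]] idn_right[OF co(2)[OF z(1)]] by simp
  qed (use z in simp)
  then have "iso_in C (xm z)" using isoI[OF co(2)[OF z(1)] g] by simp
  then show ?thesis
    using cofibration_class_cmp_iso[OF W TW T(1)[OF zt tA] _ co(2)[OF z(1)]] T(2)[OF zt tA] Xt
    by simp
qed

text \<open>The leg \<open>q j\<close> is a cobase change of the leg \<open>m\<close> of the wide pushout of the other arrows.\<close>

lemma wide_pushout_legs_in:
  fixes \<kappa> :: "'u rel"
  assumes \<kappa>: "Card_order \<kappa>" and B: "has_small_wide_pushouts \<kappa> C"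
    and W: "cofibration_class TYPE('u) C W"
    and J: "|J| <o \<kappa>" and w: "is_wide_pushout C J a f w m q"
    and f: "\<And>j. j \<in> J \<Longrightarrow> f j \<in> hom C a (Cod C (f j))"
    and fW: "\<And>j. j \<in> J \<Longrightarrow> f j \<in> W"
  shows "m \<in> W" and "\<And>j. j \<in> J \<Longrightarrow> q j \<in> W"
proof -
  have leg: "m \<in> W" if J: "|J| <o \<kappa>" and w: "is_wide_pushout C J a f w m q"
    and f: "\<And>j. j \<in> J \<Longrightarrow> f j \<in> hom C a (Cod C (f j))" "\<And>j. j \<in> J \<Longrightarrow> f j \<in> W" for J w m q
  proof -
    obtain t g where t: "t \<in> Field \<kappa>" and g: "bij_betw g (underS \<kappa> t) J"
      using bij_betw_underS_of_ordLess[OF J] .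
    have "g k \<in> J" if "k \<in> underS \<kappa> t" for k using g that by (auto simp: bij_betw_def)
    then show ?thesis
      using wide_pushout_leg_in_underS[OF \<kappa> B W t wide_pushout_reindex'[OF g w]] f by simp
  qed
  show "m \<in> W" using leg[OF J w f fW] .
  show "q j \<in> W" if j: "j \<in> J" for j
  proof -
    note co = wide_pushout_cocone[OF w]
    have "|J - {j}| <o \<kappa>" using J card_of_mono1[of "J - {j}" J] ordLeq_ordLess_trans by blast
    then obtain w0 m0 q0 where w0: "is_wide_pushout C (J - {j}) a f w0 m0 q0"
      using small_wide_pushout[OF B, of "J - {j}" a f] f hom_obs(1)[OF co(2)] by blast
    have "m0 \<in> W" using leg[OF \<open>|J - {j}| <o \<kappa>\<close> w0] f fW by blast
    moreover obtain h where "h \<in> hom C w0 w" "h \<cdot> m0 = m" "\<And>k. k \<in> J - {j} \<Longrightarrow> h \<cdot> q0 k = q k"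
      using wide_pushout_desc[OF w0 co(2), of q] co(3,4) by blast
    then have "is_pushout C (f j) m0 (q j) h"
      using wide_pushout_insert[OF w0, of j w m q h] w j f by (simp add: insert_absorb)
    ultimately show ?thesis
      using cofibration_class_cobase[OF W is_pushout_sym] by blast
  qed
qed

end

section \<open>Sequences and their colimits\<close>

text \<open>Cocones and colimits of a sequence \<open>x 0 \<rightarrow> x 1 \<rightarrow> \<dots>\<close> with arrows \<open>m n\<close> from \<open>x n\<close> to
  \<open>x (n + 1)\<close>.\<close>

definition seq_in :: "('o, 'm) cat \<Rightarrow> (nat \<Rightarrow> 'o) \<Rightarrow> (nat \<Rightarrow> 'm) \<Rightarrow> bool" where
  "seq_in C x m \<longleftrightarrow> (\<forall>n. m n \<in> hom C (x n) (x (Suc n)))"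

definition seq_cocone ::
    "('o, 'm) cat \<Rightarrow> (nat \<Rightarrow> 'o) \<Rightarrow> (nat \<Rightarrow> 'm) \<Rightarrow> 'o \<Rightarrow> (nat \<Rightarrow> 'm) \<Rightarrow> bool" where
  "seq_cocone C x m c \<mu> \<longleftrightarrow> c \<in> Ob C \<and> (\<forall>n. \<mu> n \<in> hom C (x n) c \<and> \<mu> (Suc n) \<cdot>\<^bsub>C\<^esub> m n = \<mu> n)"

definition seq_colimit ::
    "('o, 'm) cat \<Rightarrow> (nat \<Rightarrow> 'o) \<Rightarrow> (nat \<Rightarrow> 'm) \<Rightarrow> 'o \<Rightarrow> (nat \<Rightarrow> 'm) \<Rightarrow> bool" where
  "seq_colimit C x m c \<mu> \<longleftrightarrow> seq_cocone C x m c \<mu> \<and>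
     (\<forall>c' \<mu>'. seq_cocone C x m c' \<mu>' \<longrightarrow> (\<exists>!h. h \<in> hom C c c' \<and> (\<forall>n. h \<cdot>\<^bsub>C\<^esub> \<mu> n = \<mu>' n)))"

text \<open>A category isomorphic to the ordinal \<open>\<omega>\<close>: \<open>g\<close> enumerates the objects, and \<open>\<alpha> a b\<close> is the
  arrow from \<open>g a\<close> to \<open>g b\<close> for \<open>a \<le> b\<close>.\<close>

locale omega_shape =
  fixes I :: "('i, 'k) cat" and g :: "nat \<Rightarrow> 'i" and \<alpha> :: "nat \<Rightarrow> nat \<Rightarrow> 'k"
  assumes inj_g: "inj g"
    and Ob_I: "Ob I = range g"
    and Ar_I: "Ar I = {\<alpha> a b | a b. a \<le> b}"
    and Dom_I: "a \<le> b \<Longrightarrow> Dom I (\<alpha> a b) = g a"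
    and Cod_I: "a \<le> b \<Longrightarrow> Cod I (\<alpha> a b) = g b"
    and Idn_I: "Idn I (g a) = \<alpha> a a"
    and Cmp_I: "a \<le> b \<Longrightarrow> b \<le> c \<Longrightarrow> \<alpha> b c \<cdot>\<^bsub>I\<^esub> \<alpha> a b = \<alpha> a c"
begin

lemma \<alpha>_hom: "a \<le> b \<Longrightarrow> \<alpha> a b \<in> hom I (g a) (g b)"
  by (auto simp: hom_def Ar_I Dom_I Cod_I)

lemma arrowE:
  assumes "f \<in> Ar I"
  obtains a b where "a \<le> b" "f = \<alpha> a b"
  using assms by (auto simp: Ar_I)

lemma hom_shape: "f \<in> hom I (g a) (g b) \<Longrightarrow> a \<le> b \<and> f = \<alpha> a b"
  using inj_g by (auto simp: hom_def Ar_I Dom_I Cod_I inj_eq)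

lemma category_shape: "category I"
  unfolding category_def
proof (intro conjI ballI impI)
  fix f k l assume "f \<in> Ar I" "k \<in> Ar I" "l \<in> Ar I" "Cod I f = Dom I k \<and> Cod I k = Dom I l"
  then obtain a b c d where "f = \<alpha> a b" "a \<le> b" "k = \<alpha> b c" "b \<le> c" "l = \<alpha> c d" "c \<le> d"
    by (elim arrowE) (auto simp: Dom_I Cod_I inj_eq[OF inj_g])
  then show "l \<cdot>\<^bsub>I\<^esub> (k \<cdot>\<^bsub>I\<^esub> f) = l \<cdot>\<^bsub>I\<^esub> k \<cdot>\<^bsub>I\<^esub> f"
    by (simp add: Cmp_I order_trans[of a b c] order_trans[of b c d])
next
  fix f k assume "f \<in> Ar I" "k \<in> Ar I" "Cod I f = Dom I k"
  then obtain a b c where "f = \<alpha> a b" "a \<le> b" "k = \<alpha> b c" "b \<le> c"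
    by (elim arrowE) (auto simp: Dom_I Cod_I inj_eq[OF inj_g])
  then show "k \<cdot>\<^bsub>I\<^esub> f \<in> hom I (Dom I f) (Cod I k)"
    using \<alpha>_hom[of a c] by (simp add: Cmp_I Dom_I Cod_I)
next
  fix f assume "f \<in> Ar I"
  then obtain a b where "f = \<alpha> a b" "a \<le> b" by (elim arrowE)
  then show "Dom I f \<in> Ob I" "Cod I f \<in> Ob I" "f \<cdot>\<^bsub>I\<^esub> Idn I (Dom I f) = f"
    "Idn I (Cod I f) \<cdot>\<^bsub>I\<^esub> f = f"
    by (auto simp: Dom_I Cod_I Ob_I Idn_I Cmp_I)
next
  fix i assume "i \<in> Ob I"
  then show "Idn I i \<in> hom I i i" by (auto simp: Ob_I Idn_I \<alpha>_hom)
qed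

lemma filtered_shape: "filtered I"
  unfolding filtered_def
proof (intro conjI ballI category_shape)
  show "Ob I \<noteq> {}" by (simp add: Ob_I)
  fix i k assume "i \<in> Ob I" "k \<in> Ob I"
  then obtain a b where ab: "i = g a" "k = g b" by (auto simp: Ob_I)
  show "\<exists>c\<in>Ob I. hom I i c \<noteq> {} \<and> hom I k c \<noteq> {}"
    using \<alpha>_hom[of a "max a b"] \<alpha>_hom[of b "max a b"] by (auto simp: Ob_I ab)
  show "\<exists>c\<in>Ob I. \<exists>h\<in>hom I k c. h \<cdot>\<^bsub>I\<^esub> f = h \<cdot>\<^bsub>I\<^esub> f'"
    if "f \<in> hom I i k" "f' \<in> hom I i k" for f f'
  proof -
    have "f = f'" using that hom_shape unfolding ab by blast
    then show ?thesis using \<alpha>_hom[of b b] by (auto simp: ab Ob_I)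
  qed
qed

text \<open>Cocones under a functor on \<open>I\<close> are cocones under the sequence of its values.\<close>

lemma cocone_shape:
  assumes C: "category C" and D: "is_functor I C D"
  shows "is_cocone I C D c \<mu> \<longleftrightarrow>
    seq_cocone C (\<lambda>n. FOb D (g n)) (\<lambda>n. FAr D (\<alpha> n (Suc n))) c (\<lambda>n. \<mu> (g n))"
    (is "_ \<longleftrightarrow> seq_cocone C ?x ?m c ?\<mu>")
proof -
  interpret C: cat_ctx C by standard (rule C)
  have "?\<mu> b \<cdot>\<^bsub>C\<^esub> FAr D (\<alpha> a b) = ?\<mu> a" if co: "seq_cocone C ?x ?m c ?\<mu>" and ab: "a \<le> b" for a b
    using ab
  proof (induction b rule: dec_induct)
    case base
    then show ?case
      using co functor_idn[OF D, of "g a"] C.idn_right[of "?\<mu> a" "?x a" c]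
      by (simp add: Ob_I Idn_I seq_cocone_def)
  next
    case (step n)
    have "FAr D (\<alpha> a (Suc n)) = FAr D (\<alpha> n (Suc n)) \<cdot>\<^bsub>C\<^esub> FAr D (\<alpha> a n)"
      using functor_cmp[OF D \<alpha>_hom[OF step(1)] \<alpha>_hom[of n "Suc n"]] step(1) by (simp add: Cmp_I)
    then show ?case
      using co step.IH C.assoc[OF functor_hom[OF D \<alpha>_hom[OF step(1)]]
          functor_hom[OF D \<alpha>_hom[of n "Suc n"]], of "?\<mu> (Suc n)" c]
      by (simp add: seq_cocone_def)
  qed
  then have "seq_cocone C ?x ?m c ?\<mu> \<Longrightarrow> is_cocone I C D c \<mu>"
    unfolding is_cocone_def by (auto simp: Ob_I Ar_I Dom_I Cod_I seq_cocone_def)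
  moreover have "seq_cocone C ?x ?m c ?\<mu>" if co: "is_cocone I C D c \<mu>"
  proof -
    have "?\<mu> (Suc n) \<cdot>\<^bsub>C\<^esub> ?m n = ?\<mu> n" for n
      using co \<alpha>_hom[of n "Suc n"] unfolding is_cocone_def by (auto simp: hom_def)
    then show ?thesis using co unfolding seq_cocone_def is_cocone_def by (simp add: Ob_I)
  qed
  ultimately show ?thesis by blast
qed

lemma colimit_shape:
  assumes C: "category C" and D: "is_functor I C D"
  shows "is_colimit I C D c \<mu> \<longleftrightarrow>
    seq_colimit C (\<lambda>n. FOb D (g n)) (\<lambda>n. FAr D (\<alpha> n (Suc n))) c (\<lambda>n. \<mu> (g n))"
    (is "_ \<longleftrightarrow> seq_colimit C ?x ?m c ?\<mu>")
proof -
  have ob: "(\<forall>i\<in>Ob I. h \<cdot>\<^bsub>C\<^esub> \<mu> i = \<mu>' i) \<longleftrightarrow> (\<forall>n. h \<cdot>\<^bsub>C\<^esub> ?\<mu> n = \<mu>' (g n))" for h \<mu>'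
    by (simp add: Ob_I)
  have "(\<forall>c' \<mu>'. seq_cocone C ?x ?m c' (\<lambda>n. \<mu>' (g n)) \<longrightarrow>
        (\<exists>!h. h \<in> hom C c c' \<and> (\<forall>n. h \<cdot>\<^bsub>C\<^esub> ?\<mu> n = \<mu>' (g n)))) \<longleftrightarrow>
      (\<forall>c' \<nu>. seq_cocone C ?x ?m c' \<nu> \<longrightarrow> (\<exists>!h. h \<in> hom C c c' \<and> (\<forall>n. h \<cdot>\<^bsub>C\<^esub> ?\<mu> n = \<nu> n)))"
    (is "(\<forall>c' \<mu>'. ?A c' (\<lambda>n. \<mu>' (g n))) \<longleftrightarrow> _")
  proof (intro iffI allI)
    fix c' \<nu> assume *: "\<forall>c' \<mu>'. ?A c' (\<lambda>n. \<mu>' (g n))"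
    from *[rule_format, of c' "\<nu> \<circ> inv g"] show "?A c' \<nu>" by (simp add: inj_g)
  qed blast
  then show ?thesis
    unfolding is_colimit_def seq_colimit_def cocone_shape[OF C D] ob by simp
qed

end

text \<open>The composite of \<open>d\<close> consecutive arrows of a sequence, from \<open>x a\<close> to \<open>x (a + d)\<close>.\<close>

primrec seq_cmp :: "('o, 'm) cat \<Rightarrow> (nat \<Rightarrow> 'o) \<Rightarrow> (nat \<Rightarrow> 'm) \<Rightarrow> nat \<Rightarrow> nat \<Rightarrow> 'm" where
  "seq_cmp C x m a 0 = Idn C (x a)"
| "seq_cmp C x m a (Suc d) = m (a + d) \<cdot>\<^bsub>C\<^esub> seq_cmp C x m a d"

text \<open>The functor generated by a sequence, on a category \<open>I\<close> isomorphic to \<open>\<omega>\<close> with objects enumerated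
  by \<open>g\<close>.\<close>

definition seq_functor ::
    "('i, 'k) cat \<Rightarrow> (nat \<Rightarrow> 'i) \<Rightarrow> ('o, 'm) cat \<Rightarrow> (nat \<Rightarrow> 'o) \<Rightarrow> (nat \<Rightarrow> 'm) \<Rightarrow> ('i, 'k, 'o, 'm) ftr"
  where
  "seq_functor I g C x m = \<lparr> FOb = (\<lambda>i. x (inv g i)),
     FAr = (\<lambda>k. seq_cmp C x m (inv g (Dom I k)) (inv g (Cod I k) - inv g (Dom I k))) \<rparr>"

context cat_ctx
begin

lemma seq_in_ob: "seq_in C x m \<Longrightarrow> x n \<in> Ob C"
  unfolding seq_in_def using hom_obs(1) by blast

lemma seq_cmp_hom: "seq_in C x m \<Longrightarrow> seq_cmp C x m a d \<in> hom C (x a) (x (a + d))"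
proof (induction d)
  case 0
  then show ?case using idn_hom seq_in_ob by simp
next
  case (Suc d)
  then show ?case using cmp_hom[of _ "x a" "x (a + d)"] by (simp add: seq_in_def)
qed

lemma seq_cmp_add:
  assumes "seq_in C x m"
  shows "seq_cmp C x m (a + d) d' \<cdot> seq_cmp C x m a d = seq_cmp C x m a (d + d')"
proof (induction d')
  case 0
  then show ?case using idn_left[OF seq_cmp_hom[OF assms]] by simp
next
  case (Suc d')
  have "m (a + d + d') \<in> hom C (x (a + d + d')) (x (Suc (a + d + d')))"
    using assms by (simp add: seq_in_def)
  from assoc[OF seq_cmp_hom[OF assms, of a d] seq_cmp_hom[OF assms, of "a + d" d'] this]
  show ?case using Suc by (simp add: add.assoc)
qed

end

context omega_shape
begin

lemma seq_functor:
  assumes C: "category C" and x: "seq_in C x m"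
  shows "is_functor I C (seq_functor I g C x m)"
    and "FOb (seq_functor I g C x m) (g n) = x n"
    and "FAr (seq_functor I g C x m) (\<alpha> n (Suc n)) = m n"
proof -
  interpret C: cat_ctx C by standard (rule C)
  let ?D = "seq_functor I g C x m"
  have ar: "FAr ?D (\<alpha> a b) = seq_cmp C x m a (b - a)" if "a \<le> b" for a b
    using that by (simp add: seq_functor_def Dom_I Cod_I inj_g)
  show ob: "FOb ?D (g n) = x n" for n by (simp add: seq_functor_def inj_g)
  have "m n \<in> hom C (x n) (x (Suc n))" using x by (simp add: seq_in_def)
  then show "FAr ?D (\<alpha> n (Suc n)) = m n" by (simp add: ar C.idn_right)
  show "is_functor I C ?D"
    unfolding is_functor_def
  proof (intro conjI ballI impI)
    fix i assume "i \<in> Ob I"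
    then obtain a where "i = g a" by (auto simp: Ob_I)
    then show "FOb ?D i \<in> Ob C" "FAr ?D (Idn I i) = Idn C (FOb ?D i)"
      using C.seq_in_ob[OF x] by (simp_all add: ob Idn_I ar)
  next
    fix f assume "f \<in> Ar I"
    then obtain a b where "f = \<alpha> a b" "a \<le> b" by (elim arrowE)
    then show "FAr ?D f \<in> hom C (FOb ?D (Dom I f)) (FOb ?D (Cod I f))"
      using C.seq_cmp_hom[OF x, of a "b - a"] by (simp add: ar Dom_I Cod_I ob)
  next
    fix f k assume "f \<in> Ar I" "k \<in> Ar I" "Cod I f = Dom I k"
    then obtain a b c where *: "f = \<alpha> a b" "a \<le> b" "k = \<alpha> b c" "b \<le> c"
      by (elim arrowE) (auto simp: Dom_I Cod_I inj_eq[OF inj_g])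
    then show "FAr ?D (k \<cdot>\<^bsub>I\<^esub> f) = FAr ?D k \<cdot>\<^bsub>C\<^esub> FAr ?D f"
      using C.seq_cmp_add[OF x, of a "b - a" "c - b"] by (simp add: Cmp_I ar)
  qed
qed

lemma seq_colimit_iff:
  assumes "category C" "seq_in C x m"
  shows "is_colimit I C (seq_functor I g C x m) c \<mu> \<longleftrightarrow> seq_colimit C x m c (\<lambda>n. \<mu> (g n))"
  using colimit_shape[OF assms(1) seq_functor(1)[OF assms], of c \<mu>]
  by (simp add: seq_functor(2,3)[OF assms])

lemma seq_colimit_iff':
  assumes "category C" "seq_in C x m"
  shows "is_colimit I C (seq_functor I g C x m) c (\<mu> \<circ> inv g) \<longleftrightarrow> seq_colimit C x m c \<mu>"
  using seq_colimit_iff[OF assms, of c "\<mu> \<circ> inv g"] by (simp add: inj_g)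

end

text \<open>The ordinal \<open>\<omega>\<close> in two encodings, transported along an injection \<open>g\<close> of the natural numbers:
  as a category whose objects and arrows are both of type \<open>'u\<close>, the arrow from \<open>g a\<close> to \<open>g b\<close> being the
  image of a code of the pair \<open>(a, b)\<close>, and as a well-order.\<close>

definition omega_cat :: "(nat \<Rightarrow> 'u) \<Rightarrow> ('u, 'u) cat" where
  "omega_cat g = \<lparr> Ob = range g, Ar = {g (prod_encode (a, b)) | a b. a \<le> b},
     Dom = (\<lambda>k. g (fst (prod_decode (inv g k)))), Cod = (\<lambda>k. g (snd (prod_decode (inv g k)))),
     Idn = (\<lambda>i. g (prod_encode (inv g i, inv g i))),
     Cmp = (\<lambda>l k. g (prod_encode (fst (prod_decode (inv g k)), snd (prod_decode (inv g l))))) \<rparr>"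

lemma omega_shape_omega_cat:
  assumes "inj g"
  shows "omega_shape (omega_cat g) g (\<lambda>a b. g (prod_encode (a, b)))"
  using assms by unfold_locales (auto simp: omega_cat_def)

definition omega_rel :: "(nat \<Rightarrow> 'u) \<Rightarrow> 'u rel" where
  "omega_rel g = {(g a, g b) | a b. a \<le> b}"

lemma omega_rel_iff: "inj g \<Longrightarrow> (g a, g b) \<in> omega_rel g \<longleftrightarrow> a \<le> b"
  by (auto simp: omega_rel_def inj_eq)

lemma Field_omega_rel: "Field (omega_rel g) = range g"
  by (force simp: omega_rel_def Field_def)

lemma omega_shape_order_cat:
  assumes "inj g"
  shows "omega_shape (order_cat (omega_rel g)) g (\<lambda>a b. (g a, g b))"
  using assms
  by unfold_locales (simp_all add: order_cat_def Field_omega_rel, auto simp: omega_rel_def)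

lemma Well_order_omega_rel:
  assumes g: "inj g"
  shows "Well_order (omega_rel g)"
proof -
  have "wf (omega_rel g - Id)"
  proof (rule wf_subset)
    show "wf (inv_image less_than (inv g))" by simp
    show "omega_rel g - Id \<subseteq> inv_image less_than (inv g)"
      using g by (auto simp: omega_rel_def)
  qed
  moreover have "Refl (omega_rel g)"
    unfolding refl_on_def Field_omega_rel by (auto simp: omega_rel_def)
  moreover have "trans (omega_rel g)"
  proof (rule transI)
    fix i j k assume "(i, j) \<in> omega_rel g" "(j, k) \<in> omega_rel g"
    then obtain a b c where "i = g a" "j = g b" "k = g c" "a \<le> b" "b \<le> c"
      using g by (auto simp: omega_rel_def inj_eq)
    then show "(i, k) \<in> omega_rel g" using g by (simp add: omega_rel_iff)
  qed
  moreover have "antisym (omega_rel g)"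
    using g by (auto intro!: antisymI simp: omega_rel_def inj_eq)
  moreover have "Total (omega_rel g)"
    unfolding total_on_def Field_omega_rel using g by (auto simp: omega_rel_iff)
  moreover have "omega_rel g \<subseteq> Field (omega_rel g) \<times> Field (omega_rel g)"
    by (auto intro: FieldI1 FieldI2)
  ultimately show ?thesis by (simp add: order_on_defs)
qed

lemma seq_colimit_exists:
  fixes \<kappa> :: "'u rel"
  assumes C: "category C" and \<kappa>: "has_small_filtered_colimits \<kappa> C" and \<omega>: "natLeq <o \<kappa>"
    and g: "inj (g :: nat \<Rightarrow> 'u)" and x: "seq_in C x m"
  obtains c \<mu> where "seq_colimit C x m c \<mu>"
proof -
  interpret omega_shape "omega_cat g" g "\<lambda>a b. g (prod_encode (a, b))"
    using omega_shape_omega_cat[OF g] .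
  have "|Ar (omega_cat g)| \<le>o |range g|"
    by (rule card_of_mono1) (auto simp: omega_cat_def)
  then have "|Ar (omega_cat g)| \<le>o |UNIV :: nat set|"
    using card_of_image ordLeq_transitive by blast
  then have "|Ar (omega_cat g)| \<le>o natLeq"
    using card_of_nat ordLeq_ordIso_trans by blast
  then have "|Ar (omega_cat g)| <o \<kappa>" using \<omega> ordLeq_ordLess_trans by blast
  then have "has_colimit (omega_cat g) C (seq_functor (omega_cat g) g C x m)"
    using \<kappa> filtered_shape seq_functor(1)[OF C x] unfolding has_small_filtered_colimits_def by blast
  then show ?thesis
    using that seq_colimit_iff[OF C x] unfolding has_colimit_def by blast
qed

lemma creates_seq_colimit:
  assumes E: "category E" and B: "category B" and p: "is_functor E B p"
    and cr: "creates_filtered_colimits TYPE('u) E B p"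
    and g: "inj (g :: nat \<Rightarrow> 'u)" and x: "seq_in E x m"
    and colim: "seq_colimit B (\<lambda>n. FOb p (x n)) (\<lambda>n. FAr p (m n)) c' \<mu>'"
  obtains c \<mu> where "seq_colimit E x m c \<mu>"
    and "seq_colimit B (\<lambda>n. FOb p (x n)) (\<lambda>n. FAr p (m n)) (FOb p c) (\<lambda>n. FAr p (\<mu> n))"
proof -
  interpret omega_shape "omega_cat g" g "\<lambda>a b. g (prod_encode (a, b))"
    using omega_shape_omega_cat[OF g] .
  let ?D = "seq_functor (omega_cat g) g E x m"
  note D = seq_functor[OF E x]
  have pD: "is_functor (omega_cat g) B (comp_ftr p ?D)"
    using D(1) p unfolding is_functor_def comp_ftr_def hom_def by simp
  have iff: "is_colimit (omega_cat g) B (comp_ftr p ?D) c \<mu> \<longleftrightarrow>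
      seq_colimit B (\<lambda>n. FOb p (x n)) (\<lambda>n. FAr p (m n)) c (\<lambda>n. \<mu> (g n))" for c \<mu>
    using colimit_shape[OF B pD] by (simp add: comp_ftr_def D(2,3))
  have "has_colimit (omega_cat g) B (comp_ftr p ?D)"
    unfolding has_colimit_def iff
    by (intro exI[of _ c'] exI[of _ "\<mu>' \<circ> inv g"]) (use colim g in simp)
  then have *: "has_colimit (omega_cat g) E ?D \<and> (\<forall>c \<mu>. is_cocone (omega_cat g) E ?D c \<mu> \<longrightarrow>
      (is_colimit (omega_cat g) E ?D c \<mu> \<longleftrightarrow>
        is_colimit (omega_cat g) B (comp_ftr p ?D) (FOb p c) (\<lambda>i. FAr p (\<mu> i))))"
    by (intro cr[unfolded creates_filtered_colimits_def, rule_format] conjI D(1) filtered_shape)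
  from * obtain c \<mu> where c: "is_colimit (omega_cat g) E ?D c \<mu>"
    unfolding has_colimit_def by blast
  then have "is_cocone (omega_cat g) E ?D c \<mu>" by (simp add: is_colimit_def)
  with * c have "is_colimit (omega_cat g) B (comp_ftr p ?D) (FOb p c) (\<lambda>i. FAr p (\<mu> i))"
    by simp
  then have "seq_colimit B (\<lambda>n. FOb p (x n)) (\<lambda>n. FAr p (m n)) (FOb p c) (\<lambda>n. FAr p (\<mu> (g n)))"
    unfolding iff .
  moreover have "seq_colimit E x m c (\<lambda>n. \<mu> (g n))"
    using c unfolding seq_colimit_iff[OF E x] .
  ultimately show ?thesis by (rule that[rotated])
qed

lemma seq_composite_in:
  assumes C: "category C" and W: "cofibration_class TYPE('u) C W"
    and g: "inj (g :: nat \<Rightarrow> 'u)" and x: "seq_in C x m" and m: "\<And>n. m n \<in> W"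
    and c: "seq_colimit C x m c \<mu>"
  shows "\<mu> 0 \<in> W"
proof -
  interpret omega_shape "order_cat (omega_rel g)" g "\<lambda>a b. (g a, g b)"
    using omega_shape_order_cat[OF g] .
  let ?D = "seq_functor (order_cat (omega_rel g)) g C x m"
  have covers: "covers (omega_rel g) i j \<longleftrightarrow> (\<exists>n. i = g n \<and> j = g (Suc n))" for i j
  proof
    assume c: "covers (omega_rel g) i j"
    then obtain a b where ab: "i = g a" "j = g b" "a \<le> b" "a \<noteq> b"
      by (auto simp: covers_def omega_rel_def)
    then have "(i, g (Suc a)) \<in> omega_rel g" "(g (Suc a), j) \<in> omega_rel g"
      using g by (auto simp: omega_rel_iff)
    then have "g (Suc a) = g b" using c ab g by (auto simp: covers_def inj_eq)
    then show "\<exists>n. i = g n \<and> j = g (Suc n)" using ab by auto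
  next
    assume "\<exists>n. i = g n \<and> j = g (Suc n)"
    then show "covers (omega_rel g) i j"
      using g by (auto simp: covers_def omega_rel_def inj_eq)
  qed
  have "\<not> limit_elem (omega_rel g) j" for j
  proof
    assume l: "limit_elem (omega_rel g) j"
    then obtain b where b: "j = g b" by (auto simp: limit_elem_def Field_omega_rel)
    have "b \<noteq> 0"
      using l g by (auto simp: limit_elem_def underS_def b omega_rel_def inj_eq)
    then have "covers (omega_rel g) (g (b - 1)) j" unfolding covers b by (intro exI[of _ "b - 1"]) simp
    then show False using l by (auto simp: limit_elem_def)
  qed
  then have "transfinite_sequence C W (omega_rel g) ?D"
    unfolding transfinite_sequence_def
    using Well_order_omega_rel[OF g] seq_functor[OF C x] m by (auto simp: Field_omega_rel covers)
  moreover have "is_colimit (order_cat (omega_rel g)) C ?D c (\<mu> \<circ> inv g)"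
    using seq_colimit_iff'[OF C x] c by blast
  moreover have "g 0 \<in> Field (omega_rel g)" "underS (omega_rel g) (g 0) = {}"
    using g by (simp add: Field_omega_rel) (use g in \<open>auto simp: underS_def omega_rel_def inj_eq\<close>)
  ultimately have "(\<mu> \<circ> inv g) (g 0) \<in> W"
    using W unfolding cofibration_class_def closed_transfinite_composition_def by blast
  then show ?thesis using g by simp
qed

context cat_ctx
begin

lemma seq_colimit_cocone:
  assumes "seq_colimit C x m c \<mu>"
  shows "c \<in> Ob C" "\<mu> n \<in> hom C (x n) c" "\<mu> (Suc n) \<cdot> m n = \<mu> n"
  using assms by (auto simp: seq_colimit_def seq_cocone_def)

lemma seq_colimit_desc:
  assumes "seq_colimit C x m c \<mu>" "c' \<in> Ob C"
    and "\<And>n. \<nu> n \<in> hom C (x n) c'" "\<And>n. \<nu> (Suc n) \<cdot> m n = \<nu> n"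
  obtains h where "h \<in> hom C c c'" "\<And>n. h \<cdot> \<mu> n = \<nu> n"
proof -
  have "seq_cocone C x m c' \<nu>" using assms(2-4) by (simp add: seq_cocone_def)
  then have "\<exists>!h. h \<in> hom C c c' \<and> (\<forall>n. h \<cdot> \<mu> n = \<nu> n)"
    using assms(1) by (simp add: seq_colimit_def)
  with that show ?thesis by blast
qed

lemma seq_colimit_unique:
  assumes c: "seq_colimit C x m c \<mu>" and x: "seq_in C x m"
    and h: "h \<in> hom C c c'" "h' \<in> hom C c c'" "\<And>n. h \<cdot> \<mu> n = h' \<cdot> \<mu> n"
  shows "h = h'"
proof -
  note co = seq_colimit_cocone[OF c]
  have m: "m n \<in> hom C (x n) (x (Suc n))" for n using x by (simp add: seq_in_def)
  have "seq_cocone C x m c' (\<lambda>n. h \<cdot> \<mu> n)"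
    unfolding seq_cocone_def
    using hom_obs(2)[OF h(1)] cmp_hom[OF co(2) h(1)] assoc[OF m co(2) h(1)] co(3) by simp
  then have "\<exists>!k. k \<in> hom C c c' \<and> (\<forall>n. k \<cdot> \<mu> n = h \<cdot> \<mu> n)"
    using c by (simp add: seq_colimit_def)
  then show ?thesis using h by metis
qed

text \<open>Interleaved sequences \<open>y 0 \<rightarrow> x 0 \<rightarrow> y 1 \<rightarrow> x 1 \<rightarrow> \<dots>\<close> have isomorphic colimits.\<close>

lemma seq_colimit_interleave:
  assumes x: "seq_in C x m" and y: "seq_in C y k"
    and u: "\<And>n. u n \<in> hom C (x n) (y (Suc n))" and \<beta>: "\<And>n. \<beta> n \<in> hom C (y n) (x n)"
    and u\<beta>: "\<And>n. u n \<cdot> \<beta> n = k n" and \<beta>u: "\<And>n. \<beta> (Suc n) \<cdot> u n = m n"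
    and c: "seq_colimit C x m c \<mu>" and d: "seq_colimit C y k d \<nu>"
  obtains i where "i \<in> hom C c d" "iso_in C i"
    and "\<And>n. i \<cdot> \<mu> n = \<nu> (Suc n) \<cdot> u n" and "\<And>n. i \<cdot> (\<mu> n \<cdot> \<beta> n) = \<nu> n"
proof -
  note co = seq_colimit_cocone[OF c] and dco = seq_colimit_cocone[OF d]
  have k: "k n \<in> hom C (y n) (y (Suc n))" for n using y by (simp add: seq_in_def)
  have m: "m n \<in> hom C (x n) (x (Suc n))" for n using x by (simp add: seq_in_def)
  have \<nu>u: "(\<nu> (Suc (Suc n)) \<cdot> u (Suc n)) \<cdot> m n = \<nu> (Suc n) \<cdot> u n" for n
  proof -
    have "(\<nu> (Suc (Suc n)) \<cdot> u (Suc n)) \<cdot> m n = \<nu> (Suc (Suc n)) \<cdot> (u (Suc n) \<cdot> (\<beta> (Suc n) \<cdot> u n))"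
      using assoc[OF m u dco(2)] \<beta>u by simp
    also have "\<dots> = \<nu> (Suc (Suc n)) \<cdot> (k (Suc n) \<cdot> u n)"
      using assoc[OF u \<beta> u] u\<beta> by simp
    also have "\<dots> = \<nu> (Suc n) \<cdot> u n"
      using assoc[OF u k dco(2)] dco(3) by simp
    finally show ?thesis .
  qed
  have \<mu>\<beta>: "(\<mu> (Suc n) \<cdot> \<beta> (Suc n)) \<cdot> k n = \<mu> n \<cdot> \<beta> n" for n
  proof -
    have "(\<mu> (Suc n) \<cdot> \<beta> (Suc n)) \<cdot> k n = \<mu> (Suc n) \<cdot> (\<beta> (Suc n) \<cdot> (u n \<cdot> \<beta> n))"
      using assoc[OF k \<beta> co(2)] u\<beta> by simp
    also have "\<dots> = \<mu> (Suc n) \<cdot> (m n \<cdot> \<beta> n)"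
      using assoc[OF \<beta> u \<beta>] \<beta>u by simp
    also have "\<dots> = \<mu> n \<cdot> \<beta> n"
      using assoc[OF \<beta> m co(2)] co(3) by simp
    finally show ?thesis .
  qed
  obtain i where i: "i \<in> hom C c d" "\<And>n. i \<cdot> \<mu> n = \<nu> (Suc n) \<cdot> u n"
    using seq_colimit_desc[OF c dco(1) cmp_hom[OF u dco(2)] \<nu>u] by blast
  obtain g where g: "g \<in> hom C d c" "\<And>n. g \<cdot> \<nu> n = \<mu> n \<cdot> \<beta> n"
    using seq_colimit_desc[OF d co(1) cmp_hom[OF \<beta> co(2)] \<mu>\<beta>] by blast
  have i\<beta>: "i \<cdot> (\<mu> n \<cdot> \<beta> n) = \<nu> n" for n
    using assoc[OF \<beta> co(2) i(1)] i(2) assoc[OF \<beta> u dco(2)] u\<beta> dco(3) by simp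
  have "g \<cdot> i = Idn C c"
  proof (rule seq_colimit_unique[OF c x cmp_hom[OF i(1) g(1)] idn_hom[OF co(1)]])
    fix n
    have "(g \<cdot> i) \<cdot> \<mu> n = (g \<cdot> \<nu> (Suc n)) \<cdot> u n"
      using assoc[OF co(2) i(1) g(1)] assoc[OF u dco(2) g(1)] i(2) by simp
    also have "\<dots> = \<mu> n" using g(2) assoc[OF u \<beta> co(2)] \<beta>u co(3) by simp
    finally show "(g \<cdot> i) \<cdot> \<mu> n = Idn C c \<cdot> \<mu> n" using idn_left[OF co(2)] by simp
  qed
  moreover have "i \<cdot> g = Idn C d"
  proof (rule seq_colimit_unique[OF d y cmp_hom[OF g(1) i(1)] idn_hom[OF dco(1)]])
    show "(i \<cdot> g) \<cdot> \<nu> n = Idn C d \<cdot> \<nu> n" for n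
      using assoc[OF dco(2) g(1) i(1)] g(2) i\<beta> idn_left[OF dco(2)] by simp
  qed
  ultimately have "iso_in C i" using isoI[OF i(1) g(1)] by simp
  then show ?thesis using that i i\<beta> by blast
qed

end


section \<open>Towers of displacements\<close>

lemma displacement_desc:
  assumes "is_displacement E B p e \<epsilon> \<eta> u" "\<epsilon> \<in> hom B a b" "\<eta> \<in> hom E e d" "e' \<in> Ob E"
    and "h \<in> hom E e e'" "q \<in> hom B b (FOb p e')" "FAr p h = q \<cdot>\<^bsub>B\<^esub> \<epsilon>"
  obtains \<xi> where "\<xi> \<in> hom E d e'" "h = \<xi> \<cdot>\<^bsub>E\<^esub> \<eta>" "q = FAr p \<xi> \<cdot>\<^bsub>B\<^esub> u"
    and "\<And>\<xi>'. \<xi>' \<in> hom E d e' \<Longrightarrow> h = \<xi>' \<cdot>\<^bsub>E\<^esub> \<eta> \<Longrightarrow> q = FAr p \<xi>' \<cdot>\<^bsub>B\<^esub> u \<Longrightarrow> \<xi>' = \<xi>"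
proof -
  have "Cod B \<epsilon> = b" "Cod E \<eta> = d" using assms(2,3) by (auto simp: hom_def)
  then have "\<exists>!\<xi>. \<xi> \<in> hom E d e' \<and> h = \<xi> \<cdot>\<^bsub>E\<^esub> \<eta> \<and> q = FAr p \<xi> \<cdot>\<^bsub>B\<^esub> u"
    using assms(1,4-7) unfolding is_displacement_def by simp
  with that show ?thesis by blast
qed

text \<open>Starting from arrows \<open>\<beta> 0 j : P j (e 0 j) \<rightarrow> b 0\<close>, each \<open>e n j\<close> is displaced along \<open>\<beta> n j\<close>,
  and the universal maps \<open>u n j : b n \<rightarrow> P j (e (n + 1) j)\<close> are glued into the wide pushout
  \<open>b (n + 1)\<close>, whose legs \<open>\<beta> (n + 1) j\<close> are the next arrows to displace along.\<close>

locale displacement_tower = B: cat_ctx B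
  for J :: "'j set" and E :: "'j \<Rightarrow> ('eo, 'em) cat" and B :: "('bo, 'bm) cat"
    and P :: "'j \<Rightarrow> ('eo, 'em, 'bo, 'bm) ftr" and b :: "nat \<Rightarrow> 'bo" and e :: "nat \<Rightarrow> 'j \<Rightarrow> 'eo"
    and \<beta> :: "nat \<Rightarrow> 'j \<Rightarrow> 'bm" and \<eta> :: "nat \<Rightarrow> 'j \<Rightarrow> 'em" and u :: "nat \<Rightarrow> 'j \<Rightarrow> 'bm"
    and m :: "nat \<Rightarrow> 'bm" +
  assumes E: "j \<in> J \<Longrightarrow> category (E j)"
    and P: "j \<in> J \<Longrightarrow> is_functor (E j) B (P j)"
    and \<beta>_hom: "j \<in> J \<Longrightarrow> \<beta> n j \<in> hom B (FOb (P j) (e n j)) (b n)"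
    and displ: "j \<in> J \<Longrightarrow> is_displacement (E j) B (P j) (e n j) (\<beta> n j) (\<eta> n j) (u n j)"
    and \<eta>_cod: "j \<in> J \<Longrightarrow> Cod (E j) (\<eta> n j) = e (Suc n) j"
    and wide: "is_wide_pushout B J (b n) (u n) (b (Suc n)) (m n) (\<beta> (Suc n))"
begin

lemma cat_E: "j \<in> J \<Longrightarrow> cat_ctx (E j)"
  using E by (simp add: cat_ctx_def)

lemma \<eta>_hom: "j \<in> J \<Longrightarrow> \<eta> n j \<in> hom (E j) (e n j) (e (Suc n) j)"
  using displ[of j n] \<eta>_cod[of j n] by (simp add: is_displacement_def hom_def)

lemma u_hom: "j \<in> J \<Longrightarrow> u n j \<in> hom B (b n) (FOb (P j) (e (Suc n) j))"
  using displ[of j n] \<eta>_cod[of j n] \<beta>_hom[of j n] by (simp add: is_displacement_def hom_def)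

lemma u_\<beta>: "j \<in> J \<Longrightarrow> FAr (P j) (\<eta> n j) = u n j \<cdot>\<^bsub>B\<^esub> \<beta> n j"
  using displ[of j n] by (simp add: is_displacement_def)

lemma u_cod: "j \<in> J \<Longrightarrow> Cod B (u n j) = FOb (P j) (e (Suc n) j)"
  using u_hom[of j n] by (simp add: hom_def)

lemma u_hom_cod: "j \<in> J \<Longrightarrow> u n j \<in> hom B (b n) (Cod B (u n j))"
  using u_hom u_cod by simp

lemma \<beta>_u: "j \<in> J \<Longrightarrow> \<beta> (Suc n) j \<cdot>\<^bsub>B\<^esub> u n j = m n"
  using B.wide_pushout_cocone(4)[OF wide] .

lemma m_hom: "m n \<in> hom B (b n) (b (Suc n))"
  using B.wide_pushout_cocone(2)[OF wide] .

lemma seq_b: "seq_in B b m"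
  using m_hom by (simp add: seq_in_def)

lemma seq_e: "j \<in> J \<Longrightarrow> seq_in (E j) (\<lambda>n. e n j) (\<lambda>n. \<eta> n j)"
  using \<eta>_hom by (simp add: seq_in_def)

lemma seq_Pe: "j \<in> J \<Longrightarrow> seq_in B (\<lambda>n. FOb (P j) (e n j)) (\<lambda>n. FAr (P j) (\<eta> n j))"
  using functor_hom[OF P \<eta>_hom] by (simp add: seq_in_def)

end

text \<open>A tower together with its colimits: \<open>c\<close> is the colimit of the \<open>b n\<close> and \<open>l j\<close> that of the
  \<open>e n j\<close>, and \<open>i j : c \<rightarrow> P j (l j)\<close> is the isomorphism that comes from interleaving.\<close>

locale tower_colimit = displacement_tower J E B P b e \<beta> \<eta> u m
  for J :: "'j set" and E :: "'j \<Rightarrow> ('eo, 'em) cat" and B :: "('bo, 'bm) cat"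
    and P :: "'j \<Rightarrow> ('eo, 'em, 'bo, 'bm) ftr" and b e \<beta> \<eta> u m +
  fixes c :: 'bo and \<mu> :: "nat \<Rightarrow> 'bm" and l :: "'j \<Rightarrow> 'eo" and \<nu> :: "'j \<Rightarrow> nat \<Rightarrow> 'em"
    and i :: "'j \<Rightarrow> 'bm"
  assumes c: "seq_colimit B b m c \<mu>"
    and l: "j \<in> J \<Longrightarrow> seq_colimit (E j) (\<lambda>n. e n j) (\<lambda>n. \<eta> n j) (l j) (\<nu> j)"
    and i_hom: "j \<in> J \<Longrightarrow> i j \<in> hom B c (FOb (P j) (l j))"
    and i_iso: "j \<in> J \<Longrightarrow> iso_in B (i j)"
    and i_\<mu>: "j \<in> J \<Longrightarrow> i j \<cdot>\<^bsub>B\<^esub> \<mu> n = FAr (P j) (\<nu> j (Suc n)) \<cdot>\<^bsub>B\<^esub> u n j"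
    and i_\<mu>_\<beta>: "j \<in> J \<Longrightarrow> i j \<cdot>\<^bsub>B\<^esub> (\<mu> n \<cdot>\<^bsub>B\<^esub> \<beta> n j) = FAr (P j) (\<nu> j n)"

begin

lemmas co = B.seq_colimit_cocone[OF c]

lemma l_ob: "j \<in> J \<Longrightarrow> l j \<in> Ob (E j)"
  using cat_ctx.seq_colimit_cocone(1)[OF cat_E l] .

lemma \<nu>_hom: "j \<in> J \<Longrightarrow> \<nu> j n \<in> hom (E j) (e n j) (l j)"
  using cat_ctx.seq_colimit_cocone(2)[OF cat_E l] .

lemma \<nu>_\<eta>: "j \<in> J \<Longrightarrow> \<nu> j (Suc n) \<cdot>\<^bsub>E j\<^esub> \<eta> n j = \<nu> j n"
  using cat_ctx.seq_colimit_cocone(3)[OF cat_E l] .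

lemma P\<nu>_hom: "j \<in> J \<Longrightarrow> FAr (P j) (\<nu> j n) \<in> hom B (FOb (P j) (e n j)) (FOb (P j) (l j))"
  using functor_hom[OF P \<nu>_hom] .

text \<open>An arrow out of the colimit is a family of arrows \<open>q : c \<rightarrow> b'\<close>, \<open>s j : l j \<rightarrow> e' j\<close> compatible
  with the isomorphisms \<open>i j\<close> and \<open>i' j\<close>.  It is determined by its restriction to stage \<open>0\<close>: by
  induction, stage \<open>n\<close> determines the \<open>s j\<close> at stage \<open>n + 1\<close> by the universal property of the
  displacement, and these determine \<open>q\<close> at stage \<open>n + 1\<close> by that of the wide pushout.\<close>

lemma tower_colimit_unique:
  assumes e': "\<And>j. j \<in> J \<Longrightarrow> e' j \<in> Ob (E j)"
    and i': "\<And>j. j \<in> J \<Longrightarrow> i' j \<in> hom B b' (FOb (P j) (e' j))" "\<And>j. j \<in> J \<Longrightarrow> iso_in B (i' j)"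
    and q: "q \<in> hom B c b'" "q' \<in> hom B c b'"
    and s: "\<And>j. j \<in> J \<Longrightarrow> s j \<in> hom (E j) (l j) (e' j)" "\<And>j. j \<in> J \<Longrightarrow> s' j \<in> hom (E j) (l j) (e' j)"
    and sq: "\<And>j. j \<in> J \<Longrightarrow> FAr (P j) (s j) \<cdot>\<^bsub>B\<^esub> i j = i' j \<cdot>\<^bsub>B\<^esub> q"
      "\<And>j. j \<in> J \<Longrightarrow> FAr (P j) (s' j) \<cdot>\<^bsub>B\<^esub> i j = i' j \<cdot>\<^bsub>B\<^esub> q'"
    and q0: "q \<cdot>\<^bsub>B\<^esub> \<mu> 0 = q' \<cdot>\<^bsub>B\<^esub> \<mu> 0"
    and s0: "\<And>j. j \<in> J \<Longrightarrow> s j \<cdot>\<^bsub>E j\<^esub> \<nu> j 0 = s' j \<cdot>\<^bsub>E j\<^esub> \<nu> j 0"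
  shows "q = q'" and "j \<in> J \<Longrightarrow> s j = s' j"
proof -
  have Ps: "FAr (P j) (s j) \<in> hom B (FOb (P j) (l j)) (FOb (P j) (e' j))"
    "FAr (P j) (s' j) \<in> hom B (FOb (P j) (l j)) (FOb (P j) (e' j))" if j: "j \<in> J" for j
    using functor_hom[OF P[OF j]] s[OF j] by blast+
  have Pu: "FAr (P j) (t \<cdot>\<^bsub>E j\<^esub> \<nu> j (Suc n)) \<cdot>\<^bsub>B\<^esub> u n j = i' j \<cdot>\<^bsub>B\<^esub> (r \<cdot>\<^bsub>B\<^esub> \<mu> n)"
    and P\<beta>: "i' j \<cdot>\<^bsub>B\<^esub> ((r \<cdot>\<^bsub>B\<^esub> \<mu> n) \<cdot>\<^bsub>B\<^esub> \<beta> n j) = FAr (P j) (t \<cdot>\<^bsub>E j\<^esub> \<nu> j n)"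
    if j: "j \<in> J" and t: "t \<in> hom (E j) (l j) (e' j)" and r: "r \<in> hom B c b'"
      and tr: "FAr (P j) (t) \<cdot>\<^bsub>B\<^esub> i j = i' j \<cdot>\<^bsub>B\<^esub> r" for t r j n
  proof -
    note Pt = functor_hom[OF P[OF j] t]
    have "FAr (P j) (t \<cdot>\<^bsub>E j\<^esub> \<nu> j (Suc n)) \<cdot>\<^bsub>B\<^esub> u n j
        = FAr (P j) (t) \<cdot>\<^bsub>B\<^esub> (i j \<cdot>\<^bsub>B\<^esub> \<mu> n)"
      using functor_cmp[OF P[OF j] \<nu>_hom[OF j] t] B.assoc[OF u_hom[OF j] P\<nu>_hom[OF j] Pt]
        i_\<mu>[OF j] by simp
    also have "\<dots> = (i' j \<cdot>\<^bsub>B\<^esub> r) \<cdot>\<^bsub>B\<^esub> \<mu> n"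
      using B.assoc[OF co(2) i_hom[OF j] Pt] tr by simp
    also have "\<dots> = i' j \<cdot>\<^bsub>B\<^esub> (r \<cdot>\<^bsub>B\<^esub> \<mu> n)"
      using B.assoc[OF co(2) r i'(1)[OF j]] .
    finally show "FAr (P j) (t \<cdot>\<^bsub>E j\<^esub> \<nu> j (Suc n)) \<cdot>\<^bsub>B\<^esub> u n j = i' j \<cdot>\<^bsub>B\<^esub> (r \<cdot>\<^bsub>B\<^esub> \<mu> n)" .
    have "i' j \<cdot>\<^bsub>B\<^esub> ((r \<cdot>\<^bsub>B\<^esub> \<mu> n) \<cdot>\<^bsub>B\<^esub> \<beta> n j) = (i' j \<cdot>\<^bsub>B\<^esub> r) \<cdot>\<^bsub>B\<^esub> (\<mu> n \<cdot>\<^bsub>B\<^esub> \<beta> n j)"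
      using B.assoc[OF \<beta>_hom[OF j] co(2) r]
        B.assoc[OF B.cmp_hom[OF \<beta>_hom[OF j] co(2)] r i'(1)[OF j]] by simp
    also have "\<dots> = FAr (P j) (t) \<cdot>\<^bsub>B\<^esub> FAr (P j) (\<nu> j n)"
      using B.assoc[OF B.cmp_hom[OF \<beta>_hom[OF j] co(2)] i_hom[OF j] Pt] tr i_\<mu>_\<beta>[OF j] by simp
    finally show "i' j \<cdot>\<^bsub>B\<^esub> ((r \<cdot>\<^bsub>B\<^esub> \<mu> n) \<cdot>\<^bsub>B\<^esub> \<beta> n j) = FAr (P j) (t \<cdot>\<^bsub>E j\<^esub> \<nu> j n)"
      using functor_cmp[OF P[OF j] \<nu>_hom[OF j] t] by simp
  qed
  have stage: "q \<cdot>\<^bsub>B\<^esub> \<mu> n = q' \<cdot>\<^bsub>B\<^esub> \<mu> n \<and> (\<forall>j\<in>J. s j \<cdot>\<^bsub>E j\<^esub> \<nu> j n = s' j \<cdot>\<^bsub>E j\<^esub> \<nu> j n)" for n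
  proof (induction n)
    case 0
    then show ?case using q0 s0 by blast
  next
    case (Suc n)
    have sn: "s j \<cdot>\<^bsub>E j\<^esub> \<nu> j (Suc n) = s' j \<cdot>\<^bsub>E j\<^esub> \<nu> j (Suc n)" if j: "j \<in> J" for j
    proof -
      interpret Ej: cat_ctx "E j" by (rule cat_E[OF j])
      have hom: "s j \<cdot>\<^bsub>E j\<^esub> \<nu> j n \<in> hom (E j) (e n j) (e' j)"
        using Ej.cmp_hom[OF \<nu>_hom[OF j] s(1)[OF j]] .
      have q\<mu>: "i' j \<cdot>\<^bsub>B\<^esub> (q \<cdot>\<^bsub>B\<^esub> \<mu> n) \<in> hom B (b n) (FOb (P j) (e' j))"
        using B.cmp_hom[OF B.cmp_hom[OF co(2) q(1)] i'(1)[OF j]] .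
      have eq: "FAr (P j) (s j \<cdot>\<^bsub>E j\<^esub> \<nu> j n) = (i' j \<cdot>\<^bsub>B\<^esub> (q \<cdot>\<^bsub>B\<^esub> \<mu> n)) \<cdot>\<^bsub>B\<^esub> \<beta> n j"
        using P\<beta>[OF j s(1)[OF j] q(1) sq(1)[OF j]]
          B.assoc[OF \<beta>_hom[OF j] B.cmp_hom[OF co(2) q(1)] i'(1)[OF j]] by simp
      obtain \<xi> where \<xi>: "\<And>\<xi>'. \<xi>' \<in> hom (E j) (e (Suc n) j) (e' j) \<Longrightarrow>
          s j \<cdot>\<^bsub>E j\<^esub> \<nu> j n = \<xi>' \<cdot>\<^bsub>E j\<^esub> \<eta> n j \<Longrightarrow>
          i' j \<cdot>\<^bsub>B\<^esub> (q \<cdot>\<^bsub>B\<^esub> \<mu> n) = FAr (P j) \<xi>' \<cdot>\<^bsub>B\<^esub> u n j \<Longrightarrow> \<xi>' = \<xi>"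
        using displacement_desc[OF displ[OF j] \<beta>_hom[OF j] \<eta>_hom[OF j] e'[OF j] hom q\<mu> eq] by metis
      have "s j \<cdot>\<^bsub>E j\<^esub> \<nu> j (Suc n) = \<xi>"
        by (rule \<xi>) (use Ej.cmp_hom[OF \<nu>_hom[OF j] s(1)[OF j]] Ej.assoc[OF \<eta>_hom[OF j] \<nu>_hom[OF j] s(1)[OF j]]
          \<nu>_\<eta>[OF j] Pu[OF j s(1)[OF j] q(1) sq(1)[OF j]] in auto)
      moreover have "s' j \<cdot>\<^bsub>E j\<^esub> \<nu> j (Suc n) = \<xi>"
        by (rule \<xi>) (use Ej.cmp_hom[OF \<nu>_hom[OF j] s(2)[OF j]] Ej.assoc[OF \<eta>_hom[OF j] \<nu>_hom[OF j] s(2)[OF j]]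
          \<nu>_\<eta>[OF j] Pu[OF j s(2)[OF j] q(2) sq(2)[OF j]] Suc.IH j in auto)
      ultimately show ?thesis by simp
    qed
    have "q \<cdot>\<^bsub>B\<^esub> \<mu> (Suc n) = q' \<cdot>\<^bsub>B\<^esub> \<mu> (Suc n)"
    proof (rule B.wide_pushout_unique[OF wide u_hom_cod B.cmp_hom[OF co(2) q(1)] B.cmp_hom[OF co(2) q(2)]])
      show "(q \<cdot>\<^bsub>B\<^esub> \<mu> (Suc n)) \<cdot>\<^bsub>B\<^esub> m n = (q' \<cdot>\<^bsub>B\<^esub> \<mu> (Suc n)) \<cdot>\<^bsub>B\<^esub> m n"
        using B.assoc[OF m_hom co(2) q(1)] B.assoc[OF m_hom co(2) q(2)] co(3) Suc.IH by simp
      fix j assume j: "j \<in> J"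
      show "(q \<cdot>\<^bsub>B\<^esub> \<mu> (Suc n)) \<cdot>\<^bsub>B\<^esub> \<beta> (Suc n) j = (q' \<cdot>\<^bsub>B\<^esub> \<mu> (Suc n)) \<cdot>\<^bsub>B\<^esub> \<beta> (Suc n) j"
        by (rule B.iso_cancel_left[OF i'(2)[OF j] i'(1)[OF j]
              B.cmp_hom[OF \<beta>_hom[OF j] B.cmp_hom[OF co(2) q(1)]]
              B.cmp_hom[OF \<beta>_hom[OF j] B.cmp_hom[OF co(2) q(2)]]])
          (simp add: P\<beta>[OF j s(1)[OF j] q(1) sq(1)[OF j]] P\<beta>[OF j s(2)[OF j] q(2) sq(2)[OF j]] sn[OF j])
    qed
    then show ?case using sn by blast
  qed
  show "q = q'" using B.seq_colimit_unique[OF c seq_b q] stage by blast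
  show "s j = s' j" if j: "j \<in> J"
    using cat_ctx.seq_colimit_unique[OF cat_E[OF j] l[OF j] seq_e[OF j] s(1)[OF j] s(2)[OF j]] stage j
    by blast
qed

text \<open>Conversely, a compatible pair at stage \<open>0\<close> extends to the colimit.  The same universal properties
  give an extension from each stage to the next.\<close>

lemma tower_colimit_desc:
  assumes e': "\<And>j. j \<in> J \<Longrightarrow> e' j \<in> Ob (E j)"
    and i': "\<And>j. j \<in> J \<Longrightarrow> i' j \<in> hom B b' (FOb (P j) (e' j))" "\<And>j. j \<in> J \<Longrightarrow> iso_in B (i' j)"
    and q0: "q0 \<in> hom B (b 0) b'" and s0: "\<And>j. j \<in> J \<Longrightarrow> s0 j \<in> hom (E j) (e 0 j) (e' j)"
    and sq0: "\<And>j. j \<in> J \<Longrightarrow> FAr (P j) (s0 j) = i' j \<cdot>\<^bsub>B\<^esub> (q0 \<cdot>\<^bsub>B\<^esub> \<beta> 0 j)"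
  obtains q s where "q \<in> hom B c b'" "\<And>j. j \<in> J \<Longrightarrow> s j \<in> hom (E j) (l j) (e' j)"
    and "\<And>j. j \<in> J \<Longrightarrow> FAr (P j) (s j) \<cdot>\<^bsub>B\<^esub> i j = i' j \<cdot>\<^bsub>B\<^esub> q"
    and "q \<cdot>\<^bsub>B\<^esub> \<mu> 0 = q0" and "\<And>j. j \<in> J \<Longrightarrow> s j \<cdot>\<^bsub>E j\<^esub> \<nu> j 0 = s0 j"
proof -
  \<comment> \<open>\<open>x\<close> is a compatible pair \<open>(q, s)\<close> at stage \<open>n\<close>, and \<open>link\<close> says that \<open>y\<close> at stage \<open>n + 1\<close> extends \<open>x\<close>.\<close>
  define stage where "stage n x \<longleftrightarrow> fst x \<in> hom B (b n) b' \<and>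
      (\<forall>j\<in>J. snd x j \<in> hom (E j) (e n j) (e' j) \<and>
        FAr (P j) (snd x j) = i' j \<cdot>\<^bsub>B\<^esub> (fst x \<cdot>\<^bsub>B\<^esub> \<beta> n j)) \<and> (n = 0 \<longrightarrow> x = (q0, s0))" for n x
  define link where "link n x y \<longleftrightarrow> fst y \<cdot>\<^bsub>B\<^esub> m n = fst x \<and>
      (\<forall>j\<in>J. snd y j \<cdot>\<^bsub>E j\<^esub> \<eta> n j = snd x j \<and> FAr (P j) (snd y j) \<cdot>\<^bsub>B\<^esub> u n j = i' j \<cdot>\<^bsub>B\<^esub> fst x)"
    for n x y
  have "\<exists>y. stage (Suc n) y \<and> link n x y" if x: "stage n x" for n x
  proof -
    obtain q s where [simp]: "x = (q, s)" by (cases x)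
    have q: "q \<in> hom B (b n) b'" and s: "\<And>j. j \<in> J \<Longrightarrow> s j \<in> hom (E j) (e n j) (e' j)"
      and Ps: "\<And>j. j \<in> J \<Longrightarrow> FAr (P j) (s j) = i' j \<cdot>\<^bsub>B\<^esub> (q \<cdot>\<^bsub>B\<^esub> \<beta> n j)"
      using x by (auto simp: stage_def)
    have "\<exists>t. t \<in> hom (E j) (e (Suc n) j) (e' j) \<and> s j = t \<cdot>\<^bsub>E j\<^esub> \<eta> n j \<and>
        i' j \<cdot>\<^bsub>B\<^esub> q = FAr (P j) t \<cdot>\<^bsub>B\<^esub> u n j" if j: "j \<in> J" for j
    proof -
      have "FAr (P j) (s j) = (i' j \<cdot>\<^bsub>B\<^esub> q) \<cdot>\<^bsub>B\<^esub> \<beta> n j"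
        using Ps[OF j] B.assoc[OF \<beta>_hom[OF j] q i'(1)[OF j]] by simp
      from displacement_desc[OF displ[OF j] \<beta>_hom[OF j] \<eta>_hom[OF j] e'[OF j] s[OF j]
          B.cmp_hom[OF q i'(1)[OF j]] this]
      obtain t where "t \<in> hom (E j) (e (Suc n) j) (e' j)" "s j = t \<cdot>\<^bsub>E j\<^esub> \<eta> n j"
        "i' j \<cdot>\<^bsub>B\<^esub> q = FAr (P j) t \<cdot>\<^bsub>B\<^esub> u n j" .
      then show ?thesis by blast
    qed
    then have "\<forall>j\<in>J. \<exists>t. t \<in> hom (E j) (e (Suc n) j) (e' j) \<and> s j = t \<cdot>\<^bsub>E j\<^esub> \<eta> n j \<and>
        i' j \<cdot>\<^bsub>B\<^esub> q = FAr (P j) t \<cdot>\<^bsub>B\<^esub> u n j" by (rule ballI)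
    from bchoice[OF this] obtain t where t: "\<And>j. j \<in> J \<Longrightarrow> t j \<in> hom (E j) (e (Suc n) j) (e' j)"
      "\<And>j. j \<in> J \<Longrightarrow> s j = t j \<cdot>\<^bsub>E j\<^esub> \<eta> n j"
      "\<And>j. j \<in> J \<Longrightarrow> i' j \<cdot>\<^bsub>B\<^esub> q = FAr (P j) (t j) \<cdot>\<^bsub>B\<^esub> u n j" by auto
    have Pt: "FAr (P j) (t j) \<in> hom B (FOb (P j) (e (Suc n) j)) (FOb (P j) (e' j))" if j: "j \<in> J" for j
      using functor_hom[OF P[OF j] t(1)[OF j]] .
    have "\<exists>k. k \<in> hom B (FOb (P j) (e' j)) b' \<and> k \<cdot>\<^bsub>B\<^esub> i' j = Idn B b' \<and>
        i' j \<cdot>\<^bsub>B\<^esub> k = Idn B (FOb (P j) (e' j))" if j: "j \<in> J" for j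
      using B.iso_inverse[OF i'(2)[OF j] i'(1)[OF j]] by metis
    then have "\<forall>j\<in>J. \<exists>k. k \<in> hom B (FOb (P j) (e' j)) b' \<and> k \<cdot>\<^bsub>B\<^esub> i' j = Idn B b' \<and>
        i' j \<cdot>\<^bsub>B\<^esub> k = Idn B (FOb (P j) (e' j))" by (rule ballI)
    from bchoice[OF this] obtain k where k: "\<And>j. j \<in> J \<Longrightarrow> k j \<in> hom B (FOb (P j) (e' j)) b'"
      "\<And>j. j \<in> J \<Longrightarrow> k j \<cdot>\<^bsub>B\<^esub> i' j = Idn B b'"
      "\<And>j. j \<in> J \<Longrightarrow> i' j \<cdot>\<^bsub>B\<^esub> k j = Idn B (FOb (P j) (e' j))" by auto
    have kt: "k j \<cdot>\<^bsub>B\<^esub> FAr (P j) (t j) \<in> hom B (Cod B (u n j)) b'" if j: "j \<in> J" for j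
      using B.cmp_hom[OF Pt[OF j] k(1)[OF j]] u_cod[OF j] by simp
    have ktu: "(k j \<cdot>\<^bsub>B\<^esub> FAr (P j) (t j)) \<cdot>\<^bsub>B\<^esub> u n j = q" if j: "j \<in> J" for j
      using B.assoc[OF u_hom[OF j] Pt[OF j] k(1)[OF j]] t(3)[OF j]
        B.assoc[OF q i'(1)[OF j] k(1)[OF j]] k(2)[OF j] B.idn_left[OF q] by simp
    obtain r where r: "r \<in> hom B (b (Suc n)) b'" "r \<cdot>\<^bsub>B\<^esub> m n = q"
      "\<And>j. j \<in> J \<Longrightarrow> r \<cdot>\<^bsub>B\<^esub> \<beta> (Suc n) j = k j \<cdot>\<^bsub>B\<^esub> FAr (P j) (t j)"
      using B.wide_pushout_desc[OF wide q, of "\<lambda>j. k j \<cdot>\<^bsub>B\<^esub> FAr (P j) (t j)"] kt ktu by blast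
    have "FAr (P j) (t j) = i' j \<cdot>\<^bsub>B\<^esub> (r \<cdot>\<^bsub>B\<^esub> \<beta> (Suc n) j)" if j: "j \<in> J" for j
      using r(3)[OF j] B.assoc[OF Pt[OF j] k(1)[OF j] i'(1)[OF j]] k(3)[OF j]
        B.idn_left[OF Pt[OF j]] by simp
    then have "stage (Suc n) (r, t)" using r t by (simp add: stage_def)
    moreover have "link n x (r, t)" using r t by (simp add: link_def)
    ultimately show ?thesis by blast
  qed
  moreover have "\<exists>x. stage 0 x"
    using q0 s0 sq0 by (intro exI[of _ "(q0, s0)"]) (simp add: stage_def)
  ultimately obtain f where f: "\<And>n. stage n (f n)" "\<And>n. link n (f n) (f (Suc n))"
    using dependent_nat_choice[of stage link] by blast
  have f0: "f 0 = (q0, s0)" using f(1)[of 0] by (simp add: stage_def)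
  have fq: "fst (f n) \<in> hom B (b n) b'" "fst (f (Suc n)) \<cdot>\<^bsub>B\<^esub> m n = fst (f n)" for n
    using f[of n] by (simp_all add: stage_def link_def)
  have fs: "snd (f n) j \<in> hom (E j) (e n j) (e' j)"
    "snd (f (Suc n)) j \<cdot>\<^bsub>E j\<^esub> \<eta> n j = snd (f n) j"
    "FAr (P j) (snd (f (Suc n)) j) \<cdot>\<^bsub>B\<^esub> u n j = i' j \<cdot>\<^bsub>B\<^esub> fst (f n)" if "j \<in> J" for n j
    using f[of n] that by (simp_all add: stage_def link_def)
  obtain q where q: "q \<in> hom B c b'" "\<And>n. q \<cdot>\<^bsub>B\<^esub> \<mu> n = fst (f n)"
    using B.seq_colimit_desc[OF c B.hom_obs(2)[OF q0] fq] by blast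
  have "\<exists>t. t \<in> hom (E j) (l j) (e' j) \<and> (\<forall>n. t \<cdot>\<^bsub>E j\<^esub> \<nu> j n = snd (f n) j)" if j: "j \<in> J" for j
    using cat_ctx.seq_colimit_desc[OF cat_E[OF j] l[OF j] e'[OF j] fs(1,2)[OF j]] by metis
  then have "\<forall>j\<in>J. \<exists>t. t \<in> hom (E j) (l j) (e' j) \<and> (\<forall>n. t \<cdot>\<^bsub>E j\<^esub> \<nu> j n = snd (f n) j)"
    by (rule ballI)
  from bchoice[OF this] obtain s where s: "\<And>j. j \<in> J \<Longrightarrow> s j \<in> hom (E j) (l j) (e' j)"
    "\<And>j n. j \<in> J \<Longrightarrow> s j \<cdot>\<^bsub>E j\<^esub> \<nu> j n = snd (f n) j" by auto
  have "FAr (P j) (s j) \<cdot>\<^bsub>B\<^esub> i j = i' j \<cdot>\<^bsub>B\<^esub> q" if j: "j \<in> J" for j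
  proof (rule B.seq_colimit_unique[OF c seq_b])
    note Ps = functor_hom[OF P[OF j] s(1)[OF j]]
    show "FAr (P j) (s j) \<cdot>\<^bsub>B\<^esub> i j \<in> hom B c (FOb (P j) (e' j))"
      using B.cmp_hom[OF i_hom[OF j] Ps] .
    show "i' j \<cdot>\<^bsub>B\<^esub> q \<in> hom B c (FOb (P j) (e' j))" using B.cmp_hom[OF q(1) i'(1)[OF j]] .
    fix n
    have "(FAr (P j) (s j) \<cdot>\<^bsub>B\<^esub> i j) \<cdot>\<^bsub>B\<^esub> \<mu> n
        = FAr (P j) (s j \<cdot>\<^bsub>E j\<^esub> \<nu> j (Suc n)) \<cdot>\<^bsub>B\<^esub> u n j"
      using B.assoc[OF co(2) i_hom[OF j] Ps] i_\<mu>[OF j] B.assoc[OF u_hom[OF j] P\<nu>_hom[OF j] Ps]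
        functor_cmp[OF P[OF j] \<nu>_hom[OF j] s(1)[OF j]] by simp
    also have "\<dots> = (i' j \<cdot>\<^bsub>B\<^esub> q) \<cdot>\<^bsub>B\<^esub> \<mu> n"
      using s(2)[OF j] fs(3)[OF j] q(2) B.assoc[OF co(2) q(1) i'(1)[OF j]] by simp
    finally show "(FAr (P j) (s j) \<cdot>\<^bsub>B\<^esub> i j) \<cdot>\<^bsub>B\<^esub> \<mu> n = (i' j \<cdot>\<^bsub>B\<^esub> q) \<cdot>\<^bsub>B\<^esub> \<mu> n" .
  qed
  then show ?thesis using that[of q s] q s f0 by simp
qed

end

lemma (in displacement_tower) tower_colimit_exists:
  fixes \<kappa> :: "'u rel"
  assumes \<kappa>: "has_small_filtered_colimits \<kappa> B" and \<omega>: "natLeq <o \<kappa>" and g: "inj (g :: nat \<Rightarrow> 'u)"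
    and cr: "\<And>j. j \<in> J \<Longrightarrow> creates_filtered_colimits TYPE('u) (E j) B (P j)"
  obtains c \<mu> l \<nu> i where "tower_colimit J E B P b e \<beta> \<eta> u m c \<mu> l \<nu> i"
proof -
  obtain c \<mu> where c: "seq_colimit B b m c \<mu>"
    using seq_colimit_exists[OF B.category \<kappa> \<omega> g seq_b] .
  have "\<exists>x. seq_colimit (E j) (\<lambda>n. e n j) (\<lambda>n. \<eta> n j) (fst x) (fst (snd x)) \<and>
      snd (snd x) \<in> hom B c (FOb (P j) (fst x)) \<and> iso_in B (snd (snd x)) \<and>
      (\<forall>n. snd (snd x) \<cdot>\<^bsub>B\<^esub> \<mu> n = FAr (P j) (fst (snd x) (Suc n)) \<cdot>\<^bsub>B\<^esub> u n j) \<and>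
      (\<forall>n. snd (snd x) \<cdot>\<^bsub>B\<^esub> (\<mu> n \<cdot>\<^bsub>B\<^esub> \<beta> n j) = FAr (P j) (fst (snd x) n))" if j: "j \<in> J" for j
  proof -
    obtain d \<rho> where d: "seq_colimit B (\<lambda>n. FOb (P j) (e n j)) (\<lambda>n. FAr (P j) (\<eta> n j)) d \<rho>"
      using seq_colimit_exists[OF B.category \<kappa> \<omega> g seq_Pe[OF j]] .
    obtain l \<nu> where l: "seq_colimit (E j) (\<lambda>n. e n j) (\<lambda>n. \<eta> n j) l \<nu>"
      and Pl: "seq_colimit B (\<lambda>n. FOb (P j) (e n j)) (\<lambda>n. FAr (P j) (\<eta> n j)) (FOb (P j) l)
        (\<lambda>n. FAr (P j) (\<nu> n))"
      using creates_seq_colimit[OF E[OF j] B.category P[OF j] cr[OF j] g seq_e[OF j] d] .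
    obtain i where "i \<in> hom B c (FOb (P j) l)" "iso_in B i"
      "\<And>n. i \<cdot>\<^bsub>B\<^esub> \<mu> n = FAr (P j) (\<nu> (Suc n)) \<cdot>\<^bsub>B\<^esub> u n j"
      "\<And>n. i \<cdot>\<^bsub>B\<^esub> (\<mu> n \<cdot>\<^bsub>B\<^esub> \<beta> n j) = FAr (P j) (\<nu> n)"
      using B.seq_colimit_interleave[OF seq_b seq_Pe[OF j] u_hom[OF j] \<beta>_hom[OF j]
          u_\<beta>[OF j, symmetric] \<beta>_u[OF j] c Pl] by blast
    then show ?thesis using l by (intro exI[of _ "(l, \<nu>, i)"]) simp
  qed
  then have "\<forall>j\<in>J. \<exists>x. seq_colimit (E j) (\<lambda>n. e n j) (\<lambda>n. \<eta> n j) (fst x) (fst (snd x)) \<and>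
      snd (snd x) \<in> hom B c (FOb (P j) (fst x)) \<and> iso_in B (snd (snd x)) \<and>
      (\<forall>n. snd (snd x) \<cdot>\<^bsub>B\<^esub> \<mu> n = FAr (P j) (fst (snd x) (Suc n)) \<cdot>\<^bsub>B\<^esub> u n j) \<and>
      (\<forall>n. snd (snd x) \<cdot>\<^bsub>B\<^esub> (\<mu> n \<cdot>\<^bsub>B\<^esub> \<beta> n j) = FAr (P j) (fst (snd x) n))"
    by (rule ballI)
  from bchoice[OF this] obtain x where
    x: "\<forall>j\<in>J. seq_colimit (E j) (\<lambda>n. e n j) (\<lambda>n. \<eta> n j) (fst (x j)) (fst (snd (x j))) \<and>
      snd (snd (x j)) \<in> hom B c (FOb (P j) (fst (x j))) \<and> iso_in B (snd (snd (x j))) \<and>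
      (\<forall>n. snd (snd (x j)) \<cdot>\<^bsub>B\<^esub> \<mu> n = FAr (P j) (fst (snd (x j)) (Suc n)) \<cdot>\<^bsub>B\<^esub> u n j) \<and>
      (\<forall>n. snd (snd (x j)) \<cdot>\<^bsub>B\<^esub> (\<mu> n \<cdot>\<^bsub>B\<^esub> \<beta> n j) = FAr (P j) (fst (snd (x j)) n))"
    by (elim exE)
  have "tower_colimit J E B P b e \<beta> \<eta> u m c \<mu> (\<lambda>j. fst (x j)) (\<lambda>j. fst (snd (x j)))
      (\<lambda>j. snd (snd (x j)))"
    by unfold_locales (use c x in auto)
  then show ?thesis by (rule that)
qed

text \<open>The colimit of a tower that starts from \<open>\<beta> 0 j = \<epsilon> \<circ> (i\<^sub>0 j)\<inverse>\<close> is the displacement of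
  \<open>(b\<^sub>0, e 0, i\<^sub>0)\<close> along \<open>\<epsilon>\<close>.\<close>

lemma (in tower_colimit) displacement_pseudopullback:
  assumes x: "(b0, e 0, i0) \<in> pp_obs J E B P"
    and \<epsilon>: "\<epsilon> \<in> hom B b0 (b 0)" "\<And>j. j \<in> J \<Longrightarrow> \<beta> 0 j \<cdot>\<^bsub>B\<^esub> i0 j = \<epsilon>"
  shows "\<exists>\<zeta>. is_displacement (pseudopullback J E B P) B pp_proj (b0, e 0, i0) \<epsilon> \<zeta> (\<mu> 0)"
proof -
  let ?C = "pseudopullback J E B P"
  let ?p = "pp_proj :: (('j, 'eo, 'bo, 'bm) pp_ob, ('j, 'eo, 'em, 'bo, 'bm) pp_ar, 'bo, 'bm) ftr"
  let ?x = "(b0, e 0, i0)" and ?y = "(c, restrict l J, restrict i J)"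
  let ?\<zeta> = "(?x, ?y, \<mu> 0 \<cdot>\<^bsub>B\<^esub> \<epsilon>, \<lambda>j\<in>J. \<nu> j 0)"
  have homC: "k \<in> hom ?C a a' \<longleftrightarrow> (\<exists>\<sigma> s. k = (a, a', \<sigma>, s) \<and> k \<in> pp_ars J E B P)" for k a a'
    by (cases k) (auto simp: hom_def pseudopullback_def)
  have i0: "i0 j \<in> hom B b0 (FOb (P j) (e 0 j))" "iso_in B (i0 j)" if "j \<in> J" for j
    using x that by (auto simp: pp_obs_def)
  have y: "?y \<in> pp_obs J E B P"
    using co(1) l_ob i_hom i_iso by (auto simp: pp_obs_def)
  have \<mu>\<epsilon>: "\<mu> 0 \<cdot>\<^bsub>B\<^esub> \<epsilon> \<in> hom B b0 c" using B.cmp_hom[OF \<epsilon>(1) co(2)] .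
  have "FAr (P j) (\<nu> j 0) \<cdot>\<^bsub>B\<^esub> i0 j = i j \<cdot>\<^bsub>B\<^esub> (\<mu> 0 \<cdot>\<^bsub>B\<^esub> \<epsilon>)" if j: "j \<in> J" for j
  proof -
    have "FAr (P j) (\<nu> j 0) \<cdot>\<^bsub>B\<^esub> i0 j = i j \<cdot>\<^bsub>B\<^esub> ((\<mu> 0 \<cdot>\<^bsub>B\<^esub> \<beta> 0 j) \<cdot>\<^bsub>B\<^esub> i0 j)"
      using i_\<mu>_\<beta>[OF j, of 0]
        B.assoc[OF i0(1)[OF j] B.cmp_hom[OF \<beta>_hom[OF j] co(2)] i_hom[OF j]] by simp
    then show ?thesis using B.assoc[OF i0(1)[OF j] \<beta>_hom[OF j] co(2)] \<epsilon>(2)[OF j] by simp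
  qed
  then have \<zeta>: "?\<zeta> \<in> pp_ars J E B P"
    using x y \<mu>\<epsilon> \<nu>_hom by (simp add: pp_ars_def)
  have "\<exists>!\<xi>. \<xi> \<in> hom ?C ?y y' \<and> h = \<xi> \<cdot>\<^bsub>?C\<^esub> ?\<zeta> \<and> q = FAr ?p \<xi> \<cdot>\<^bsub>B\<^esub> \<mu> 0"
    if y': "y' \<in> Ob ?C" and h: "h \<in> hom ?C ?x y'" and q: "q \<in> hom B (b 0) (FOb ?p y')"
      and hq: "FAr ?p h = q \<cdot>\<^bsub>B\<^esub> \<epsilon>" for y' h q
  proof -
    obtain b' e' i' where y'_eq: "y' = (b', e', i')" by (cases y')
    obtain \<sigma> s where h_eq: "h = (?x, y', \<sigma>, s)" and "h \<in> pp_ars J E B P"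
      using h homC by blast
    then have s: "s \<in> extensional J" "\<And>j. j \<in> J \<Longrightarrow> s j \<in> hom (E j) (e 0 j) (e' j)"
      and si: "\<And>j. j \<in> J \<Longrightarrow> FAr (P j) (s j) \<cdot>\<^bsub>B\<^esub> i0 j = i' j \<cdot>\<^bsub>B\<^esub> \<sigma>"
      by (auto simp: pp_ars_def y'_eq PiE_iff)
    have \<sigma>: "\<sigma> = q \<cdot>\<^bsub>B\<^esub> \<epsilon>" and q': "q \<in> hom B (b 0) b'"
      using hq q by (simp_all add: h_eq pp_proj_def y'_eq)
    have y'': "(b', e', i') \<in> pp_obs J E B P" using y' by (simp add: y'_eq pseudopullback_def)
    then have e': "e' j \<in> Ob (E j)" and i': "i' j \<in> hom B b' (FOb (P j) (e' j))" "iso_in B (i' j)"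
      if "j \<in> J" for j
      using that by (auto simp: pp_obs_def)
    have "FAr (P j) (s j) = i' j \<cdot>\<^bsub>B\<^esub> (q \<cdot>\<^bsub>B\<^esub> \<beta> 0 j)" if j: "j \<in> J" for j
    proof (rule B.iso_cancel_right[OF i0(2)[OF j] i0(1)[OF j]])
      note q\<beta> = B.cmp_hom[OF \<beta>_hom[OF j] q']
      show "FAr (P j) (s j) \<in> hom B (FOb (P j) (e 0 j)) (FOb (P j) (e' j))"
        using functor_hom[OF P[OF j] s(2)[OF j]] .
      show "i' j \<cdot>\<^bsub>B\<^esub> (q \<cdot>\<^bsub>B\<^esub> \<beta> 0 j) \<in> hom B (FOb (P j) (e 0 j)) (FOb (P j) (e' j))"
        using B.cmp_hom[OF q\<beta> i'(1)[OF j]] .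
      show "FAr (P j) (s j) \<cdot>\<^bsub>B\<^esub> i0 j = (i' j \<cdot>\<^bsub>B\<^esub> (q \<cdot>\<^bsub>B\<^esub> \<beta> 0 j)) \<cdot>\<^bsub>B\<^esub> i0 j"
        using B.assoc[OF i0(1)[OF j] q\<beta> i'(1)[OF j]] B.assoc[OF i0(1)[OF j] \<beta>_hom[OF j] q']
          \<epsilon>(2)[OF j] si[OF j] \<sigma> by simp
    qed
    from tower_colimit_desc[OF e' i' q' s(2) this]
    obtain r t where r: "r \<in> hom B c b'" and t: "\<And>j. j \<in> J \<Longrightarrow> t j \<in> hom (E j) (l j) (e' j)"
      and tr: "\<And>j. j \<in> J \<Longrightarrow> FAr (P j) (t j) \<cdot>\<^bsub>B\<^esub> i j = i' j \<cdot>\<^bsub>B\<^esub> r"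
      and r0: "r \<cdot>\<^bsub>B\<^esub> \<mu> 0 = q" and t0: "\<And>j. j \<in> J \<Longrightarrow> t j \<cdot>\<^bsub>E j\<^esub> \<nu> j 0 = s j"
      by blast
    let ?\<xi> = "(?y, y', r, restrict t J)"
    have "?\<xi> \<in> pp_ars J E B P"
      using y y'' r t tr by (simp add: pp_ars_def y'_eq)
    moreover have "h = ?\<xi> \<cdot>\<^bsub>?C\<^esub> ?\<zeta>"
    proof -
      have "s = (\<lambda>j\<in>J. t j \<cdot>\<^bsub>E j\<^esub> \<nu> j 0)"
        by (rule extensionalityI[OF s(1)]) (use t0 in auto)
      moreover have "\<sigma> = r \<cdot>\<^bsub>B\<^esub> (\<mu> 0 \<cdot>\<^bsub>B\<^esub> \<epsilon>)"
        using B.assoc[OF \<epsilon>(1) co(2) r] r0 \<sigma> by simp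
      ultimately show ?thesis by (simp add: h_eq pseudopullback_def cong: restrict_cong)
    qed
    moreover have "\<xi> = ?\<xi>" if \<xi>: "\<xi> \<in> hom ?C ?y y'" "h = \<xi> \<cdot>\<^bsub>?C\<^esub> ?\<zeta>" "q = FAr ?p \<xi> \<cdot>\<^bsub>B\<^esub> \<mu> 0" for \<xi>
    proof -
      obtain r' t' where \<xi>_eq: "\<xi> = (?y, y', r', t')" and "\<xi> \<in> pp_ars J E B P"
        using \<xi>(1) homC by blast
      then have r': "r' \<in> hom B c b'" and t': "t' \<in> extensional J"
        "\<And>j. j \<in> J \<Longrightarrow> t' j \<in> hom (E j) (l j) (e' j)"
        and tr': "\<And>j. j \<in> J \<Longrightarrow> FAr (P j) (t' j) \<cdot>\<^bsub>B\<^esub> i j = i' j \<cdot>\<^bsub>B\<^esub> r'"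
        by (auto simp: pp_ars_def y'_eq PiE_iff)
      have "s = (\<lambda>j\<in>J. t' j \<cdot>\<^bsub>E j\<^esub> (\<lambda>j\<in>J. \<nu> j 0) j)"
        using \<xi>(2) by (simp add: h_eq \<xi>_eq pseudopullback_def)
      then have "t' j \<cdot>\<^bsub>E j\<^esub> \<nu> j 0 = t j \<cdot>\<^bsub>E j\<^esub> \<nu> j 0" if "j \<in> J" for j
        using t0[OF that] that by simp
      moreover have "r' \<cdot>\<^bsub>B\<^esub> \<mu> 0 = r \<cdot>\<^bsub>B\<^esub> \<mu> 0"
        using \<xi>(3) r0 by (simp add: \<xi>_eq pp_proj_def)
      ultimately have "r' = r" "\<And>j. j \<in> J \<Longrightarrow> t' j = t j"
        using tower_colimit_unique[OF e' i' r' r t'(2) t tr' tr] by blast+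
      moreover then have "t' = restrict t J"
        by (intro extensionalityI[OF t'(1)]) auto
      ultimately show ?thesis by (simp add: \<xi>_eq)
    qed
    moreover have "q = FAr ?p ?\<xi> \<cdot>\<^bsub>B\<^esub> \<mu> 0" using r0 by (simp add: pp_proj_def)
    ultimately show ?thesis using homC by blast
  qed
  moreover have "\<mu> 0 \<in> hom B (Cod B \<epsilon>) c" using co(2) \<epsilon>(1) by (simp add: hom_def)
  moreover have "?\<zeta> \<in> Ar ?C" "Dom ?C ?\<zeta> = ?x" "Cod ?C ?\<zeta> = ?y" "FOb ?p ?y = c"
    "FAr ?p ?\<zeta> = \<mu> 0 \<cdot>\<^bsub>B\<^esub> \<epsilon>" "Cod B \<epsilon> = b 0"
    using \<zeta> \<epsilon>(1) by (simp_all add: pseudopullback_def pp_proj_def hom_def)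
  ultimately show ?thesis
    unfolding is_displacement_def by (intro exI[of _ ?\<zeta>]) simp
qed

section \<open>Displacements in pseudopullbacks\<close>

text \<open>Left perfectness with respect to one class \<open>W\<close> of arrows.  For the class of all arrows this
  is the existence of displacements, so that existence and left perfectness have one common proof.\<close>

definition displaces_in ::
    "('eo, 'em) cat \<Rightarrow> ('bo, 'bm) cat \<Rightarrow> ('eo, 'em, 'bo, 'bm) ftr \<Rightarrow> 'bm set \<Rightarrow> bool" where
  "displaces_in E B p W \<longleftrightarrow> (\<forall>e\<in>Ob E. \<forall>\<epsilon>\<in>W. Dom B \<epsilon> = FOb p e \<longrightarrow>
     (\<exists>\<eta> u. is_displacement E B p e \<epsilon> \<eta> u \<and> u \<in> W))"

lemma left_perfect_iff:
  "left_perfect E B p cof tcof \<longleftrightarrow> displaces_in E B p cof \<and> displaces_in E B p tcof"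
  unfolding left_perfect_def left_perfect_at_def displaces_in_def ball_conj_distrib ..

lemma has_displacements_iff:
  "(\<forall>e\<in>Ob E. has_displacements E B p e) \<longleftrightarrow> displaces_in E B p (Ar B)"
proof -
  have "u \<in> Ar B" if "is_displacement E B p e \<epsilon> \<eta> u" for e \<epsilon> \<eta> u
    using that by (simp add: is_displacement_def hom_def)
  then show ?thesis unfolding has_displacements_def displaces_in_def by blast
qed

lemma cofibration_class_Ar: "cofibration_class TYPE('u) C (Ar C)"
proof -
  have "closed_transfinite_composition TYPE('u) C (Ar C)"
    unfolding closed_transfinite_composition_def is_colimit_def is_cocone_def
    by (auto simp: hom_def order_cat_def)
  moreover have "closed_cobase_change C (Ar C)"
    unfolding closed_cobase_change_def is_pushout_def by blast
  ultimately show ?thesis by (simp add: cofibration_class_def)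
qed

text \<open>If the initial arrows lie in \<open>W\<close>, then the whole tower can be built in \<open>W\<close>.\<close>

lemma displacement_tower_exists:
  fixes \<kappa> :: "'u rel"
  assumes B: "category B" and E: "\<And>j. j \<in> J \<Longrightarrow> category (E j)"
    and P: "\<And>j. j \<in> J \<Longrightarrow> is_functor (E j) B (P j)"
    and \<kappa>: "Card_order \<kappa>" "has_small_wide_pushouts \<kappa> B" and J: "|J| <o \<kappa>"
    and W: "cofibration_class TYPE('u) B W"
    and disp: "\<And>j. j \<in> J \<Longrightarrow> displaces_in (E j) B (P j) W"
    and b\<^sub>0: "b\<^sub>0 \<in> Ob B" and e\<^sub>0: "\<And>j. j \<in> J \<Longrightarrow> e\<^sub>0 j \<in> Ob (E j)"
    and \<beta>\<^sub>0: "\<And>j. j \<in> J \<Longrightarrow> \<beta>\<^sub>0 j \<in> W" "\<And>j. j \<in> J \<Longrightarrow> \<beta>\<^sub>0 j \<in> hom B (FOb (P j) (e\<^sub>0 j)) b\<^sub>0"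
  obtains b e \<beta> \<eta> u m where "displacement_tower J E B P b e \<beta> \<eta> u m"
    and "b 0 = b\<^sub>0" "e 0 = e\<^sub>0" "\<beta> 0 = \<beta>\<^sub>0" and "\<And>n. m n \<in> W"
proof -
  interpret B: cat_ctx B by standard (rule B)
  \<comment> \<open>The data \<open>(b, e, \<beta>)\<close> of a stage of the tower, and the passage from one stage to the next.\<close>
  define stage where "stage n x \<longleftrightarrow> (case x of (b, e, \<beta>) \<Rightarrow> b \<in> Ob B \<and>
      (\<forall>j\<in>J. e j \<in> Ob (E j) \<and> \<beta> j \<in> W \<and> \<beta> j \<in> hom B (FOb (P j) (e j)) b) \<and>
      (n = 0 \<longrightarrow> x = (b\<^sub>0, e\<^sub>0, \<beta>\<^sub>0)))" for n :: nat and x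
  define step where "step x y \<eta> u m \<longleftrightarrow> (case (x, y) of ((b, e, \<beta>), (b', e', \<beta>')) \<Rightarrow>
      (\<forall>j\<in>J. is_displacement (E j) B (P j) (e j) (\<beta> j) (\<eta> j) (u j) \<and> Cod (E j) (\<eta> j) = e' j) \<and>
      is_wide_pushout B J b u b' m \<beta>' \<and> m \<in> W)" for x y \<eta> u m
  define link where "link n x y \<longleftrightarrow> (\<exists>\<eta> u m. step x y \<eta> u m)" for n :: nat and x y
  have "\<exists>y. stage (Suc n) y \<and> link n x y" if x: "stage n x" for n x
  proof -
    obtain b e \<beta> where x_eq: "x = (b, e, \<beta>)" by (cases x)
    have b: "b \<in> Ob B" and e: "\<And>j. j \<in> J \<Longrightarrow> e j \<in> Ob (E j)" and \<beta>W: "\<And>j. j \<in> J \<Longrightarrow> \<beta> j \<in> W"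
      and \<beta>: "\<And>j. j \<in> J \<Longrightarrow> \<beta> j \<in> hom B (FOb (P j) (e j)) b"
      using x by (auto simp: stage_def x_eq)
    have "\<forall>j\<in>J. \<exists>y. is_displacement (E j) B (P j) (e j) (\<beta> j) (fst y) (snd y) \<and> snd y \<in> W"
      using disp e \<beta>W \<beta> unfolding displaces_in_def hom_def by fastforce
    from bchoice[OF this] obtain y where
      y: "\<forall>j\<in>J. is_displacement (E j) B (P j) (e j) (\<beta> j) (fst (y j)) (snd (y j)) \<and> snd (y j) \<in> W"
      by (elim exE)
    define \<eta> u where "\<eta> j = fst (y j)" and "u j = snd (y j)" for j
    have d: "is_displacement (E j) B (P j) (e j) (\<beta> j) (\<eta> j) (u j)" and uW: "u j \<in> W"
      if "j \<in> J" for j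
      using y that by (simp_all add: \<eta>_def u_def)
    have u: "u j \<in> hom B b (FOb (P j) (Cod (E j) (\<eta> j)))" if "j \<in> J" for j
      using d[OF that] \<beta>[OF that] by (simp add: is_displacement_def hom_def)
    then have u': "u j \<in> hom B b (Cod B (u j))" if "j \<in> J" for j
      using that by (auto simp: hom_def)
    have \<eta>: "Cod (E j) (\<eta> j) \<in> Ob (E j)" if "j \<in> J" for j
      using d[OF that] cat_ctx.dom_cod_ob(2)[of "E j"] E[OF that]
      by (simp add: is_displacement_def cat_ctx_def)
    obtain b' m \<beta>' where w: "is_wide_pushout B J b u b' m \<beta>'"
      using B.small_wide_pushout[OF \<kappa>(2) J b u'] .
    note legs = B.wide_pushout_legs_in[OF \<kappa> W J w u' uW] and co = B.wide_pushout_cocone[OF w]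
    have "\<beta>' j \<in> hom B (FOb (P j) (Cod (E j) (\<eta> j))) b'" if "j \<in> J" for j
      using co(3)[OF that] u[OF that] by (simp add: hom_def)
    then have "stage (Suc n) (b', \<lambda>j. Cod (E j) (\<eta> j), \<beta>')"
      using co(1) \<eta> legs by (simp add: stage_def)
    moreover have "step x (b', \<lambda>j. Cod (E j) (\<eta> j), \<beta>') \<eta> u m"
      using d w legs by (simp add: step_def x_eq)
    ultimately show ?thesis unfolding link_def by blast
  qed
  moreover have "\<exists>x. stage 0 x"
    using b\<^sub>0 e\<^sub>0 \<beta>\<^sub>0 by (intro exI[of _ "(b\<^sub>0, e\<^sub>0, \<beta>\<^sub>0)"]) (simp add: stage_def)
  ultimately obtain f where f: "\<And>n. stage n (f n)" "\<And>n. link n (f n) (f (Suc n))"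
    using dependent_nat_choice[of stage link] by blast
  define b e \<beta> where "b n = fst (f n)" and "e n = fst (snd (f n))" and "\<beta> n = snd (snd (f n))" for n
  have f_eq: "f n = (b n, e n, \<beta> n)" for n by (simp add: b_def e_def \<beta>_def)
  have "\<forall>n. \<exists>y. step (f n) (f (Suc n)) (fst y) (fst (snd y)) (snd (snd y))"
    using f(2) unfolding link_def by simp
  from choice[OF this] obtain y where
    y: "\<And>n. step (f n) (f (Suc n)) (fst (y n)) (fst (snd (y n))) (snd (snd (y n)))"
    by blast
  have "displacement_tower J E B P b e \<beta>
      (\<lambda>n. fst (y n)) (\<lambda>n. fst (snd (y n))) (\<lambda>n. snd (snd (y n)))"
  proof unfold_locales
    fix j n assume j: "j \<in> J"
    show "\<beta> n j \<in> hom B (FOb (P j) (e n j)) (b n)"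
      using f(1)[of n] j by (simp add: stage_def f_eq)
    show "is_displacement (E j) B (P j) (e n j) (\<beta> n j) (fst (y n) j) (fst (snd (y n)) j)"
      and "Cod (E j) (fst (y n) j) = e (Suc n) j"
      using y[of n] j by (simp_all add: step_def f_eq)
  qed (use E P y in \<open>simp_all add: step_def f_eq\<close>)
  moreover have "snd (snd (y n)) \<in> W" for n using y[of n] by (simp add: step_def f_eq)
  moreover have "b 0 = b\<^sub>0" "e 0 = e\<^sub>0" "\<beta> 0 = \<beta>\<^sub>0"
    using f(1)[of 0] by (simp_all add: stage_def f_eq)
  ultimately show ?thesis using that by blast
qed

lemma displaces_in_pseudopullback:
  fixes \<kappa> :: "'u rel"
  assumes \<kappa>: "Card_order \<kappa>" and \<omega>: "natLeq <o \<kappa>" and J: "|J| <o \<kappa>"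
    and B: "category B" and E: "\<And>j. j \<in> J \<Longrightarrow> category (E j)"
    and P: "\<And>j. j \<in> J \<Longrightarrow> is_functor (E j) B (P j)"
    and cr: "\<And>j. j \<in> J \<Longrightarrow> creates_filtered_colimits TYPE('u) (E j) B (P j)"
    and colim: "has_small_filtered_colimits \<kappa> B" "has_small_wide_pushouts \<kappa> B"
    and W: "cofibration_class TYPE('u) B W"
    and disp: "\<And>j. j \<in> J \<Longrightarrow> displaces_in (E j) B (P j) W"
  shows "displaces_in (pseudopullback J E B P) B pp_proj W"
proof -
  interpret B: cat_ctx B by standard (rule B)
  obtain g :: "nat \<Rightarrow> 'u" where g: "inj g"
  proof -
    have "|UNIV :: nat set| \<le>o \<kappa>"
      using card_of_nat \<omega> ordIso_ordLess_trans ordLess_imp_ordLeq by blast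
    then have "|UNIV :: nat set| \<le>o |Field \<kappa>|"
      using card_of_Field_ordIso[OF \<kappa>] ordIso_symmetric ordLeq_ordIso_trans by blast
    then show ?thesis using that unfolding card_of_ordLeq[symmetric] by blast
  qed
  have "\<exists>\<zeta> v. is_displacement (pseudopullback J E B P) B pp_proj x \<epsilon> \<zeta> v \<and> v \<in> W"
    if x: "x \<in> Ob (pseudopullback J E B P)" and \<epsilon>: "\<epsilon> \<in> W" "Dom B \<epsilon> = fst x" for x \<epsilon>
  proof -
    obtain b0 e0 i0 where x_eq: "x = (b0, e0, i0)" by (cases x)
    have obs: "(b0, e0, i0) \<in> pp_obs J E B P" using x by (simp add: x_eq pseudopullback_def)
    then have e0: "e0 j \<in> Ob (E j)" and i0: "i0 j \<in> hom B b0 (FOb (P j) (e0 j))" "iso_in B (i0 j)"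
      if "j \<in> J" for j
      using that by (auto simp: pp_obs_def)
    have \<epsilon>_hom: "\<epsilon> \<in> hom B b0 (Cod B \<epsilon>)"
      using W \<epsilon> by (auto simp: cofibration_class_def hom_def x_eq)
    have "\<forall>j\<in>J. \<exists>k. k \<in> hom B (FOb (P j) (e0 j)) b0 \<and> iso_in B k \<and> k \<cdot>\<^bsub>B\<^esub> i0 j = Idn B b0"
    proof
      fix j assume j: "j \<in> J"
      obtain k where "k \<in> hom B (FOb (P j) (e0 j)) b0" "k \<cdot>\<^bsub>B\<^esub> i0 j = Idn B b0"
        "i0 j \<cdot>\<^bsub>B\<^esub> k = Idn B (FOb (P j) (e0 j))"
        using B.iso_inverse[OF i0(2,1)[OF j]] .
      then show "\<exists>k. k \<in> hom B (FOb (P j) (e0 j)) b0 \<and> iso_in B k \<and> k \<cdot>\<^bsub>B\<^esub> i0 j = Idn B b0"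
        using B.isoI[OF _ i0(1)[OF j]] by blast
    qed
    from bchoice[OF this] obtain k where k: "\<And>j. j \<in> J \<Longrightarrow> k j \<in> hom B (FOb (P j) (e0 j)) b0"
      "\<And>j. j \<in> J \<Longrightarrow> iso_in B (k j)" "\<And>j. j \<in> J \<Longrightarrow> k j \<cdot>\<^bsub>B\<^esub> i0 j = Idn B b0"
      by blast
    obtain b e \<beta> \<eta> u m where tower: "displacement_tower J E B P b e \<beta> \<eta> u m"
      and start: "b 0 = Cod B \<epsilon>" "e 0 = e0" "\<beta> 0 = (\<lambda>j. \<epsilon> \<cdot>\<^bsub>B\<^esub> k j)" and mW: "\<And>n. m n \<in> W"
      by (rule displacement_tower_exists[where J = J and E = E and P = P and e\<^sub>0 = e0 and
            \<beta>\<^sub>0 = "\<lambda>j. \<epsilon> \<cdot>\<^bsub>B\<^esub> k j", OF B E P \<kappa> colim(2) J W disp B.hom_obs(2)[OF \<epsilon>_hom] e0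
            B.cofibration_class_cmp_iso[OF W \<epsilon>(1) \<epsilon>_hom k(2,1)] B.cmp_hom[OF k(1) \<epsilon>_hom]]) blast+
    interpret displacement_tower J E B P b e \<beta> \<eta> u m by (rule tower)
    obtain c \<mu> l \<nu> i where lim: "tower_colimit J E B P b e \<beta> \<eta> u m c \<mu> l \<nu> i"
      using tower_colimit_exists[OF colim(1) \<omega> g cr] by blast
    interpret tower_colimit J E B P b e \<beta> \<eta> u m c \<mu> l \<nu> i by (rule lim)
    have "\<beta> 0 j \<cdot>\<^bsub>B\<^esub> i0 j = \<epsilon>" if j: "j \<in> J" for j
      using B.assoc[OF i0(1)[OF j] k(1)[OF j] \<epsilon>_hom] k(3)[OF j] B.idn_right[OF \<epsilon>_hom] start(3)
      by simp
    then have "\<exists>\<zeta>. is_displacement (pseudopullback J E B P) B pp_proj x \<epsilon> \<zeta> (\<mu> 0)"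
      using displacement_pseudopullback[of b0 i0 \<epsilon>] obs \<epsilon>_hom start(1,2) by (simp add: x_eq)
    moreover have "\<mu> 0 \<in> W"
      using seq_composite_in[OF B W g seq_b mW c] .
    ultimately show ?thesis by blast
  qed
  then show ?thesis
    unfolding displaces_in_def by (auto simp: pp_proj_def)
qed

theorem lemma3p4:
  fixes \<kappa> \<nu> :: "'u rel"
    and J :: "'j set"
    and E :: "'j \<Rightarrow> ('eo, 'em) cat"
    and B :: "('bo, 'bm) cat"
    and P :: "'j \<Rightarrow> ('eo, 'em, 'bo, 'bm) ftr"
  assumes "Card_order \<kappa>" and "regularCard \<kappa>"
    and "Card_order \<nu>" and "cinfinite \<nu>" and "regularCard \<nu>" and "\<nu> <o \<kappa>"
    and "|J| <o \<kappa>"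
    and "category B"
    and "\<And>j. j \<in> J \<Longrightarrow> category (E j)"
    and "\<And>j. j \<in> J \<Longrightarrow> is_functor (E j) B (P j)"
    and "\<And>j e. j \<in> J \<Longrightarrow> e \<in> Ob (E j) \<Longrightarrow> has_displacements (E j) B (P j) e"
    and "\<And>j. j \<in> J \<Longrightarrow> creates_filtered_colimits TYPE('u) (E j) B (P j)"
    and "has_small_filtered_colimits \<kappa> B"
    and "has_small_wide_pushouts \<kappa> B"
  shows "(\<forall>e \<in> Ob (pseudopullback J E B P).
            has_displacements (pseudopullback J E B P) B pp_proj e) \<and>
         (\<forall>cof tcof.
            cofibration_class TYPE('u) B cof \<and> cofibration_class TYPE('u) B tcof \<and>
            (\<forall>j\<in>J. left_perfect (E j) B (P j) cof tcof) \<longrightarrow>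
            left_perfect (pseudopullback J E B P) B pp_proj cof tcof)"
proof -
  have "natLeq \<le>o \<nu>" using natLeq_ordLeq_cinfinite assms(3,4) by blast
  then have \<omega>: "natLeq <o \<kappa>" using assms(6) ordLeq_ordLess_trans by blast
  have pp: "displaces_in (pseudopullback J E B P) B pp_proj W"
    if "cofibration_class TYPE('u) B W" "\<And>j. j \<in> J \<Longrightarrow> displaces_in (E j) B (P j) W" for W
    by (rule displaces_in_pseudopullback[OF assms(1) \<omega> assms(7-10,12-14) that])
  have "displaces_in (E j) B (P j) (Ar B)" if "j \<in> J" for j
    using assms(11) that has_displacements_iff by blast
  then have "displaces_in (pseudopullback J E B P) B pp_proj (Ar B)"
    using pp[OF cofibration_class_Ar] by blast
  then show ?thesis
    unfolding has_displacements_iff left_perfect_iff using pp by blast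
qed

end
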